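(* Fix an integer $k\ge 2$, constants $\alpha>0$, $r>0$, $0<p<1$, and let $X$ be the number of solutions of a random instance of Model RB with parameters $(n,\alpha,r,k,p)$. Let $\tau=\frac{1}{1-p}$ and $r_{cr}=\frac{1}{\ln\tau}$. If $(2k-1)\alpha>1$ and $k\ge \frac{\tau\ln\tau}{\tau-1}$, then $\lim_{n\to\infty}\Pr[X>0]=1$ if $r<r_{cr}$, and $\lim_{n\to\infty}\Pr[X>0]=0$ if $r>r_{cr}$.
   Context: Model RB with parameters $(n,\alpha,r,k,p)$, where $n$ is the number of variables, $\alpha>0$, $r>0$, $k\ge 2$ an integer and $0<p<1$: there are $n$ variables $x_1,\dots,x_n$, each with the same domain $D$ of size $d=n^{\alpha}$ (treated as an integer). A random instance is generated as follows: (1) select, independently with repetition, $t=rn\ln d$ constraints, the scope of each being a set of $k$ distinct variables chosen uniformly at random among the $n$ variables; (2) for each constraint, select uniformly at random without repetition a set of $q=p\,d^{k}$ "incompatible" tuples from $D^{k}$ (so the constraint's relation consists of the remaining $(1-p)d^k$ tuples). An assignment of values from $D$ to all variables is a solution if, for every constraint, the tuple of values assigned to its scope is not incompatible. Limits are taken as $n\to\infty$ with $\alpha,r,k,p$ fixed. *)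

theory Defs
  imports "HOL-Probability.Probability"
begin

definition rb_dom_size :: "nat \<Rightarrow> real \<Rightarrow> nat" where
  "rb_dom_size n \<alpha> = nat \<lfloor>real n powr \<alpha>\<rfloor>"

definition rb_num_constraints :: "nat \<Rightarrow> real \<Rightarrow> real \<Rightarrow> nat" where
  "rb_num_constraints n \<alpha> r = nat \<lfloor>r * real n * ln (real (rb_dom_size n \<alpha>))\<rfloor>"

definition rb_num_incompat :: "nat \<Rightarrow> nat \<Rightarrow> real \<Rightarrow> nat" where
  "rb_num_incompat d k p = nat \<lfloor>p * real d ^ k\<rfloor>"

definition rb_tuples :: "nat \<Rightarrow> nat \<Rightarrow> nat list set" where
  "rb_tuples d k = {xs. length xs = k \<and> set xs \<subseteq> {0..<d}}"

text \<open>A constraint: a scope (set of k distinct variables) and a set of incompatible tuples.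
  The tuple of a scope is read in increasing order of variable index.\<close>
type_synonym rb_constraint = "nat set \<times> nat list set"

definition rb_constraint_pmf :: "nat \<Rightarrow> nat \<Rightarrow> nat \<Rightarrow> nat \<Rightarrow> rb_constraint pmf" where
  "rb_constraint_pmf n d k q = do {
     S \<leftarrow> pmf_of_set {S. S \<subseteq> {0..<n} \<and> card S = k};
     R \<leftarrow> pmf_of_set {R. R \<subseteq> rb_tuples d k \<and> card R = q};
     return_pmf (S, R) }"

definition rb_instance_pmf :: "nat \<Rightarrow> real \<Rightarrow> real \<Rightarrow> nat \<Rightarrow> real \<Rightarrow> rb_constraint list pmf" where
  "rb_instance_pmf n \<alpha> r k p =
     (let d = rb_dom_size n \<alpha> in
      replicate_pmf (rb_num_constraints n \<alpha> r) (rb_constraint_pmf n d k (rb_num_incompat d k p)))"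

definition rb_assignments :: "nat \<Rightarrow> nat \<Rightarrow> (nat \<Rightarrow> nat) set" where
  "rb_assignments n d = PiE {0..<n} (\<lambda>_. {0..<d})"

definition rb_is_solution :: "rb_constraint list \<Rightarrow> (nat \<Rightarrow> nat) \<Rightarrow> bool" where
  "rb_is_solution I \<sigma> = (\<forall>c \<in> set I. map \<sigma> (sorted_list_of_set (fst c)) \<notin> snd c)"

definition rb_num_solutions :: "nat \<Rightarrow> real \<Rightarrow> rb_constraint list \<Rightarrow> nat" where
  "rb_num_solutions n \<alpha> I = card {\<sigma> \<in> rb_assignments n (rb_dom_size n \<alpha>). rb_is_solution I \<sigma>}"

definition rb_prob_sat :: "nat \<Rightarrow> real \<Rightarrow> real \<Rightarrow> nat \<Rightarrow> real \<Rightarrow> real" where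
  "rb_prob_sat n \<alpha> r k p =
     measure_pmf.prob (rb_instance_pmf n \<alpha> r k p) {I. rb_num_solutions n \<alpha> I > 0}"

end

theory Submission
  imports Defs "HOL-Real_Asymp.Real_Asymp"
begin

text \<open>
  For \<open>r > r_cr\<close> the expected number of solutions tends to \<open>0\<close>. For \<open>r < r_cr\<close> the second moment
  method applies, but since \<open>\<alpha>\<close> may be below \<open>1/k\<close> it has to be carried out exactly. With
  \<open>N = d^k\<close>, two assignments agreeing on exactly \<open>m\<close> variables contribute to \<open>E[X^2] / E[X]^2\<close>
  the factor \<open>(1 + c (N P(m) - 1) / (N - 1))^t\<close>, where \<open>P(m) = (m choose k) / (n choose k)\<close> and
  \<open>m\<close> is binomial with parameters \<open>n\<close> and \<open>1/d\<close>. Because \<open>N P(m)\<close> has mean \<open>1\<close>, only the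
  fluctuations of \<open>m\<close> matter; on the scale \<open>sqrt (n/d)\<close> they are negligible because
  \<open>(2k - 1) \<alpha> > 1\<close>. The condition on \<open>k\<close> gives \<open>ln (1 + c s^k) \<le> s ln (1 + c)\<close> for \<open>0 \<le> s \<le> 1\<close>,
  which together with \<open>r < r_cr\<close> controls the pairs with large overlap.
\<close>

subsection \<open>One constraint\<close>

lemma prob_bind_pmf:
  "measure_pmf.prob (bind_pmf M f) A = (\<integral>x. measure_pmf.prob (f x) A \<partial>measure_pmf M)"
  unfolding measure_pmf_bind
  by (rule measure_pmf.measure_bind[where N = "count_space UNIV"])
     (auto simp: space_subprob_algebra intro: prob_space_imp_subprob_space measure_pmf.prob_space_axioms)

text \<open>Independence of the constraints: peeling off the first draw contributes one factor
  \<open>measure_pmf.prob M A\<close>. Both moments use it, with A the set of constraints satisfied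
  by one assignment or by two at once.\<close>

lemma prob_replicate_pmf_subset:
  "measure_pmf.prob (replicate_pmf t M) {xs. set xs \<subseteq> A} = measure_pmf.prob M A ^ t"
proof (induction t)
  case 0
  then show ?case by simp
next
  case (Suc t)
  have "measure_pmf.prob (replicate_pmf (Suc t) M) {xs. set xs \<subseteq> A}
      = (\<integral>x. measure_pmf.prob (bind_pmf (replicate_pmf t M) (\<lambda>xs. return_pmf (x # xs))) {xs. set xs \<subseteq> A} \<partial>M)"
    by (simp add: prob_bind_pmf)
  also have "\<dots> = (\<integral>x. indicator A x * measure_pmf.prob M A ^ t \<partial>M)"
  proof (rule Bochner_Integration.integral_cong[OF refl])
    fix x
    have "measure_pmf.prob (bind_pmf (replicate_pmf t M) (\<lambda>xs. return_pmf (x # xs))) {xs. set xs \<subseteq> A}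
      = measure_pmf.prob (replicate_pmf t M) ((#) x -` {xs. set xs \<subseteq> A})"
      by (simp flip: map_pmf_def)
    also have "(#) x -` {xs. set xs \<subseteq> A} = (if x \<in> A then {xs. set xs \<subseteq> A} else {})" by auto
    finally show "measure_pmf.prob (bind_pmf (replicate_pmf t M) (\<lambda>xs. return_pmf (x # xs))) {xs. set xs \<subseteq> A}
       = indicator A x * measure_pmf.prob M A ^ t" using Suc by simp
  qed
  also have "\<dots> = measure_pmf.prob M A ^ Suc t" by simp
  finally show ?case .
qed

text \<open>A q-subset of T that misses V is a q-subset of T - V. In the applications V consists of
  the one or two tuples that a scope reads off from the assignments.\<close>

lemma prob_subsets_avoiding:
  assumes "finite T" "q \<le> card T" "V \<subseteq> T"
  shows "measure_pmf.prob (pmf_of_set {R. R \<subseteq> T \<and> card R = q}) {R. R \<inter> V = {}}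
    = real ((card T - card V) choose q) / real (card T choose q)"
proof -
  have fin: "finite {R. R \<subseteq> T \<and> card R = q}" using assms(1) by auto
  have c: "card {R. R \<subseteq> T \<and> card R = q} = card T choose q" using n_subsets[OF assms(1)] .
  then have ne: "{R. R \<subseteq> T \<and> card R = q} \<noteq> {}"
    using assms(2) by (metis card.empty binomial_eq_0_iff not_less)
  have "{R. R \<subseteq> T \<and> card R = q} \<inter> {R. R \<inter> V = {}} = {R. R \<subseteq> T - V \<and> card R = q}" by auto
  moreover have "card {R. R \<subseteq> T - V \<and> card R = q} = (card T - card V) choose q"
    using n_subsets[of "T - V" q] assms by (simp add: card_Diff_subset finite_subset)
  ultimately show ?thesis using fin ne c by (simp add: measure_pmf_of_set)
qed

lemma binomial_ratio_1:
  assumes "q \<le> N" "N \<ge> 1"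
  shows "real ((N - 1) choose q) / real (N choose q) = (real N - real q) / real N"
proof -
  have "real ((N - q) * (N choose q)) = real (N * ((N - 1) choose q))"
    using binomial_absorb_comp by presburger
  moreover have "N choose q > 0" using assms by (simp add: zero_less_binomial_iff)
  ultimately show ?thesis using assms by (simp add: field_simps of_nat_diff)
qed

text \<open>Telescopes through ((N - 1) choose q), which is nonzero because q < N, and applies
  \<open>binomial_ratio_1\<close> to each of the two quotients.\<close>

lemma binomial_ratio_2:
  assumes "q < N" "N \<ge> 2"
  shows "real ((N - 2) choose q) / real (N choose q)
    = (real N - real q) * (real N - real q - 1) / (real N * (real N - 1))"
proof -
  have e: "N - 1 - 1 = N - 2" by simp
  have "real ((N - 2) choose q) / real ((N - 1) choose q) = (real N - real q - 1) / (real N - 1)"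
    using binomial_ratio_1[of q "N - 1"] assms unfolding e by (simp add: of_nat_diff)
  moreover have "real ((N - 1) choose q) > 0" using assms by (simp add: zero_less_binomial_iff)
  moreover have "real ((N - 2) choose q) / real (N choose q) =
     (real ((N - 2) choose q) / real ((N - 1) choose q)) * (real ((N - 1) choose q) / real (N choose q))"
    using calculation(2) by simp
  moreover have "real ((N - 1) choose q) / real (N choose q) = (real N - real q) / real N"
    using binomial_ratio_1[of q N] assms by simp
  ultimately show ?thesis by (simp only: times_divide_times_eq mult.commute)
qed

text \<open>With this set, being a solution is an inclusion of \<open>set I\<close>, so two
  simultaneous solutions correspond to an intersection and \<open>prob_replicate_pmf_subset\<close>
  covers both cases.\<close>

definition satisfying :: "(nat \<Rightarrow> nat) \<Rightarrow> rb_constraint set" where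
  "satisfying \<sigma> = {c. map \<sigma> (sorted_list_of_set (fst c)) \<notin> snd c}"

lemma rb_is_solution_iff: "rb_is_solution I \<sigma> \<longleftrightarrow> set I \<subseteq> satisfying \<sigma>"
  by (auto simp: rb_is_solution_def satisfying_def)

lemma card_rb_tuples: "card (rb_tuples d k) = d ^ k"
  using card_lists_length_eq[of "{0..<d}" k] by (simp add: rb_tuples_def conj_commute)

lemma finite_rb_tuples: "finite (rb_tuples d k)"
  using finite_lists_length_eq[of "{0..<d}" k] by (simp add: rb_tuples_def conj_commute)

lemma restriction_in_rb_tuples:
  assumes "\<sigma> \<in> rb_assignments n d" "S \<subseteq> {0..<n}" "card S = k"
  shows "map \<sigma> (sorted_list_of_set S) \<in> rb_tuples d k"
proof -
  have "finite S" using assms(2) finite_subset by blast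
  then show ?thesis using assms by (auto simp: rb_tuples_def rb_assignments_def PiE_def Pi_def)
qed

lemma prob_rb_constraint_pmf:
  assumes "k \<le> n"
  shows "measure_pmf.prob (rb_constraint_pmf n d k q) A =
    (\<Sum>S | S \<subseteq> {0..<n} \<and> card S = k.
       measure_pmf.prob (pmf_of_set {R. R \<subseteq> rb_tuples d k \<and> card R = q}) {R. (S, R) \<in> A}) / real (n choose k)"
proof -
  let ?SS = "{S. S \<subseteq> {0..<n} \<and> card S = k}"
  have fin: "finite ?SS" by simp
  have c: "card ?SS = n choose k" using n_subsets[of "{0..<n}" k] by simp
  then have ne: "?SS \<noteq> {}" using assms by (metis card.empty binomial_eq_0_iff not_less)
  have "measure_pmf.prob (rb_constraint_pmf n d k q) A = (\<integral>S. measure_pmf.prob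
      (map_pmf (Pair S) (pmf_of_set {R. R \<subseteq> rb_tuples d k \<and> card R = q})) A \<partial>pmf_of_set ?SS)"
    by (simp add: rb_constraint_pmf_def prob_bind_pmf flip: map_pmf_def)
  also have "\<dots> = (\<Sum>S\<in>?SS. measure_pmf.prob
      (map_pmf (Pair S) (pmf_of_set {R. R \<subseteq> rb_tuples d k \<and> card R = q})) A) / real (card ?SS)"
    using integral_pmf_of_set[OF ne fin] by blast
  finally show ?thesis unfolding c by (simp add: vimage_def)
qed

lemma prob_satisfying:
  assumes "k \<le> n" "q \<le> d ^ k" "d \<ge> 1" "\<sigma> \<in> rb_assignments n d"
  shows "measure_pmf.prob (rb_constraint_pmf n d k q) (satisfying \<sigma>) = 1 - real q / real d ^ k"
proof -
  let ?SS = "{S. S \<subseteq> {0..<n} \<and> card S = k}"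
  have c: "card ?SS = n choose k" using n_subsets[of "{0..<n}" k] by simp
  have "measure_pmf.prob (pmf_of_set {R. R \<subseteq> rb_tuples d k \<and> card R = q}) {R. (S, R) \<in> satisfying \<sigma>}
      = 1 - real q / real d ^ k" if "S \<in> ?SS" for S
  proof -
    have "{R. (S, R) \<in> satisfying \<sigma>} = {R. R \<inter> {map \<sigma> (sorted_list_of_set S)} = {}}"
      by (auto simp: satisfying_def)
    then show ?thesis
      using prob_subsets_avoiding[OF finite_rb_tuples, of q d k "{map \<sigma> (sorted_list_of_set S)}"]
        restriction_in_rb_tuples[OF assms(4)] that assms binomial_ratio_1[of q "d ^ k"]
      by (simp add: card_rb_tuples diff_divide_distrib)
  qed
  then show ?thesis using assms c by (simp add: prob_rb_constraint_pmf zero_less_binomial_iff)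
qed

definition agreement :: "nat \<Rightarrow> (nat \<Rightarrow> nat) \<Rightarrow> (nat \<Rightarrow> nat) \<Rightarrow> nat set" where
  "agreement n \<sigma> \<sigma>' = {i \<in> {0..<n}. \<sigma> i = \<sigma>' i}"

text \<open>A mixture: with probability P the random scope lies inside the m variables of agreement
  and only one tuple must be compatible; otherwise two different tuples must be.\<close>

definition pair_prob :: "nat \<Rightarrow> nat \<Rightarrow> nat \<Rightarrow> nat \<Rightarrow> nat \<Rightarrow> real" where
  "pair_prob n d k q m = (let N = real d ^ k; P = real (m choose k) / real (n choose k) in
     P * (1 - real q / N) + (1 - P) * ((N - real q) * (N - real q - 1) / (N * (N - 1))))"

text \<open>On a fixed scope S the two assignments read the same tuple exactly when S lies in the
  agreement set. Counting the scopes of either kind gives the weights P and 1 - P.\<close>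

lemma prob_satisfying_pair:
  assumes "1 \<le> k" "k \<le> n" "q < d ^ k" "d \<ge> 2" "\<sigma> \<in> rb_assignments n d" "\<sigma>' \<in> rb_assignments n d"
  shows "measure_pmf.prob (rb_constraint_pmf n d k q) (satisfying \<sigma> \<inter> satisfying \<sigma>')
     = pair_prob n d k q (card (agreement n \<sigma> \<sigma>'))"
proof -
  let ?N = "real d ^ k"
  let ?G = "agreement n \<sigma> \<sigma>'"
  let ?SS = "{S. S \<subseteq> {0..<n} \<and> card S = k}"
  let ?a = "1 - real q / ?N" and ?b = "(?N - real q) * (?N - real q - 1) / (?N * (?N - 1))"
  have c: "card ?SS = n choose k" using n_subsets[of "{0..<n}" k] by simp
  have "d ^ 1 \<le> d ^ k" by (rule power_increasing) (use assms in auto)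
  then have N2: "d ^ k \<ge> 2" using assms by simp
  have pr: "measure_pmf.prob (pmf_of_set {R. R \<subseteq> rb_tuples d k \<and> card R = q}) {R. (S, R) \<in> satisfying \<sigma> \<inter> satisfying \<sigma>'}
      = (if S \<subseteq> ?G then ?a else ?b)" if S: "S \<in> ?SS" for S
  proof -
    let ?v = "map \<sigma> (sorted_list_of_set S)" and ?v' = "map \<sigma>' (sorted_list_of_set S)"
    have fS: "finite S" using S finite_subset by blast
    have "{R. (S, R) \<in> satisfying \<sigma> \<inter> satisfying \<sigma>'} = {R. R \<inter> {?v, ?v'} = {}}"
      by (auto simp: satisfying_def)
    moreover have "{?v, ?v'} \<subseteq> rb_tuples d k"
      using restriction_in_rb_tuples S assms by auto
    moreover have "?v = ?v' \<longleftrightarrow> S \<subseteq> ?G" using S fS by (auto simp: agreement_def)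
    ultimately show ?thesis
      using prob_subsets_avoiding[OF finite_rb_tuples, of q d k "{?v,?v'}"] assms N2
        binomial_ratio_1[of q "d ^ k"] binomial_ratio_2[of q "d ^ k"]
      by (auto simp: card_rb_tuples diff_divide_distrib card_insert_if numeral_2_eq_2)
  qed
  have g: "{S \<in> ?SS. S \<subseteq> ?G} = {S. S \<subseteq> ?G \<and> card S = k}" by (auto simp: agreement_def)
  have cg: "card {S \<in> ?SS. S \<subseteq> ?G} = card ?G choose k"
    unfolding g by (rule n_subsets) (auto simp: agreement_def)
  have "{S \<in> ?SS. S \<subseteq> ?G} \<union> {S \<in> ?SS. \<not> S \<subseteq> ?G} = ?SS" by auto
  then have "card ?SS = card {S \<in> ?SS. S \<subseteq> ?G} + card {S \<in> ?SS. \<not> S \<subseteq> ?G}"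
    by (subst card_Un_disjoint[symmetric]) auto
  then have cn: "real (card {S \<in> ?SS. \<not> S \<subseteq> ?G}) = real (n choose k) - real (card ?G choose k)"
    using c cg by simp
  have "(\<Sum>S\<in>?SS. measure_pmf.prob (pmf_of_set {R. R \<subseteq> rb_tuples d k \<and> card R = q})
        {R. (S, R) \<in> satisfying \<sigma> \<inter> satisfying \<sigma>'}) = (\<Sum>S\<in>?SS. if S \<subseteq> ?G then ?a else ?b)"
    by (rule sum.cong[OF refl pr])
  also have "\<dots> = real (card ?G choose k) * ?a + (real (n choose k) - real (card ?G choose k)) * ?b"
    using cg cn by (subst sum.If_cases) (auto simp: Collect_conj_eq[symmetric] Int_def)
  finally have sums: "(\<Sum>S\<in>?SS. measure_pmf.prob (pmf_of_set {R. R \<subseteq> rb_tuples d k \<and> card R = q})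
        {R. (S, R) \<in> satisfying \<sigma> \<inter> satisfying \<sigma>'})
      = real (card ?G choose k) * ?a + (real (n choose k) - real (card ?G choose k)) * ?b" .
  have average: "(x * a + (c - x) * b) / c = x / c * a + (1 - x / c) * b" if "c > 0" for x a b c :: real
    using that by (simp add: field_simps)
  have "real (n choose k) > 0" using assms by (simp add: zero_less_binomial_iff)
  then show ?thesis
    unfolding prob_rb_constraint_pmf[OF assms(2)] pair_prob_def Let_def sums by (rule average)
qed

subsection \<open>First and second moments\<close>

lemma card_rb_assignments: "card (rb_assignments n d) = d ^ n"
  by (simp add: rb_assignments_def card_PiE)

lemma finite_rb_assignments: "finite (rb_assignments n d)"
  by (simp add: rb_assignments_def finite_PiE)

text \<open>The assignments in question form a product set: the value is forced on G, and at each
  variable outside G every value but that of \<open>\<sigma>\<close> is allowed.\<close>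

lemma card_agreement_eq:
  assumes "\<sigma> \<in> rb_assignments n d" "G \<subseteq> {0..<n}"
  shows "card {\<sigma>' \<in> rb_assignments n d. agreement n \<sigma> \<sigma>' = G} = (d - 1) ^ (n - card G)"
proof -
  have "{\<sigma>' \<in> rb_assignments n d. agreement n \<sigma> \<sigma>' = G}
      = PiE {0..<n} (\<lambda>i. if i \<in> G then {\<sigma> i} else {0..<d} - {\<sigma> i})"
  proof (intro set_eqI iffI)
    fix \<sigma>' assume "\<sigma>' \<in> {\<sigma>' \<in> rb_assignments n d. agreement n \<sigma> \<sigma>' = G}"
    then show "\<sigma>' \<in> PiE {0..<n} (\<lambda>i. if i \<in> G then {\<sigma> i} else {0..<d} - {\<sigma> i})"
      by (auto simp: rb_assignments_def agreement_def PiE_iff)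
  next
    fix \<sigma>' assume *: "\<sigma>' \<in> PiE {0..<n} (\<lambda>i. if i \<in> G then {\<sigma> i} else {0..<d} - {\<sigma> i})"
    have "\<sigma>' i < d \<and> (\<sigma> i = \<sigma>' i \<longleftrightarrow> i \<in> G)" if "i < n" for i
      using PiE_mem[OF *, of i] that assms by (cases "i \<in> G") (auto simp: rb_assignments_def PiE_iff)
    then show "\<sigma>' \<in> {\<sigma>' \<in> rb_assignments n d. agreement n \<sigma> \<sigma>' = G}"
      using PiE_arb[OF *] assms(2) by (auto simp: rb_assignments_def agreement_def PiE_iff extensional_def)
  qed
  then have "card {\<sigma>' \<in> rb_assignments n d. agreement n \<sigma> \<sigma>' = G}
      = (\<Prod>i\<in>{0..<n}. card (if i \<in> G then {\<sigma> i} else {0..<d} - {\<sigma> i}))"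
    by (simp add: card_PiE)
  also have "\<dots> = (\<Prod>i\<in>{0..<n}. if i \<in> G then 1 else d - 1)"
    using assms by (intro prod.cong) (auto simp: rb_assignments_def dest!: PiE_mem)
  also have "\<dots> = (d - 1) ^ card ({0..<n} - G)"
    by (simp add: prod.If_cases Diff_eq)
  also have "card ({0..<n} - G) = n - card G"
    using assms by (simp add: card_Diff_subset finite_subset)
  finally show ?thesis .
qed

text \<open>Groups first by the agreement set and then by its size. The result is the same for every
  \<open>\<sigma>\<close>, so the outer sum in the second moment contributes only a factor
  \<open>d ^ n\<close>; divided by \<open>d ^ n\<close>, the coefficients are binomial probabilities
  with parameters n and 1/d.\<close>

lemma sum_over_agreement:
  fixes g :: "nat \<Rightarrow> real"
  assumes "\<sigma> \<in> rb_assignments n d"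
  shows "(\<Sum>\<sigma>'\<in>rb_assignments n d. g (card (agreement n \<sigma> \<sigma>')))
    = (\<Sum>m\<le>n. real (n choose m) * real (d - 1) ^ (n - m) * g m)"
proof -
  have "(\<Sum>\<sigma>'\<in>rb_assignments n d. g (card (agreement n \<sigma> \<sigma>')))
      = (\<Sum>G\<in>Pow {0..<n}. \<Sum>\<sigma>'\<in>{\<sigma>'\<in>rb_assignments n d. agreement n \<sigma> \<sigma>' = G}. g (card (agreement n \<sigma> \<sigma>')))"
    by (rule sum.group[symmetric]) (auto simp: finite_rb_assignments agreement_def)
  also have "\<dots> = (\<Sum>G\<in>Pow {0..<n}. real (d - 1) ^ (n - card G) * g (card G))"
    using card_agreement_eq[OF assms] by (intro sum.cong) auto
  also have "\<dots> = (\<Sum>m\<in>{..n}. \<Sum>G\<in>{G\<in>Pow {0..<n}. card G = m}. real (d - 1) ^ (n - card G) * g (card G))"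
    by (rule sum.group[symmetric]) (auto intro: subset_eq_atLeast0_lessThan_card)
  also have "\<dots> = (\<Sum>m\<le>n. real (n choose m) * real (d - 1) ^ (n - m) * g m)"
  proof (intro sum.cong refl)
    fix m
    have "card {G \<in> Pow {0..<n}. card G = m} = n choose m"
      using n_subsets[of "{0..<n}" m] by (simp add: Pow_def)
    then show "(\<Sum>G\<in>{G\<in>Pow {0..<n}. card G = m}. real (d - 1) ^ (n - card G) * g (card G))
        = real (n choose m) * real (d - 1) ^ (n - m) * g m"
      by simp
  qed
  finally show ?thesis .
qed

lemma integrable_indicator_pmf: "integrable (measure_pmf M) (indicat_real A)"
  by (rule measure_pmf.integrable_const_bound[where B = 1]) auto

definition num_solutions :: "nat \<Rightarrow> nat \<Rightarrow> rb_constraint list \<Rightarrow> real" where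
  "num_solutions n d I = (\<Sum>\<sigma>\<in>rb_assignments n d. indicator {I. set I \<subseteq> satisfying \<sigma>} I)"

lemma rb_num_solutions_eq: "real (rb_num_solutions n \<alpha> I) = num_solutions n (rb_dom_size n \<alpha>) I"
proof -
  let ?A = "rb_assignments n (rb_dom_size n \<alpha>)"
  have "num_solutions n (rb_dom_size n \<alpha>) I = (\<Sum>\<sigma>\<in>?A. if set I \<subseteq> satisfying \<sigma> then 1 else 0)"
    unfolding num_solutions_def by (intro sum.cong) (simp_all add: indicator_def)
  also have "\<dots> = (\<Sum>\<sigma>\<in>{\<sigma> \<in> ?A. set I \<subseteq> satisfying \<sigma>}. 1)"
    by (rule sum.inter_filter[OF finite_rb_assignments, symmetric])
  finally show ?thesis by (simp add: rb_num_solutions_def rb_is_solution_iff)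
qed

lemma expectation_num_solutions:
  assumes "k \<le> n" "q \<le> d ^ k" "d \<ge> 1"
  shows "measure_pmf.expectation (replicate_pmf t (rb_constraint_pmf n d k q)) (num_solutions n d)
    = real d ^ n * (1 - real q / real d ^ k) ^ t"
proof -
  have "measure_pmf.expectation (replicate_pmf t (rb_constraint_pmf n d k q)) (num_solutions n d)
    = (\<Sum>\<sigma>\<in>rb_assignments n d. measure_pmf.prob (replicate_pmf t (rb_constraint_pmf n d k q))
         {I. set I \<subseteq> satisfying \<sigma>})"
    unfolding num_solutions_def
    by (subst Bochner_Integration.integral_sum) (auto simp: integrable_indicator_pmf)
  also have "\<dots> = (\<Sum>\<sigma>\<in>rb_assignments n d. (1 - real q / real d ^ k) ^ t)"
    using assms by (intro sum.cong) (auto simp: prob_replicate_pmf_subset prob_satisfying)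
  finally show ?thesis by (simp add: card_rb_assignments)
qed

lemma expectation_num_solutions_sq:
  assumes "1 \<le> k" "k \<le> n" "q < d ^ k" "d \<ge> 2"
  shows "measure_pmf.expectation (replicate_pmf t (rb_constraint_pmf n d k q)) (\<lambda>I. (num_solutions n d I)\<^sup>2)
    = real d ^ n * (\<Sum>m\<le>n. real (n choose m) * real (d - 1) ^ (n - m) * pair_prob n d k q m ^ t)"
proof -
  let ?M = "replicate_pmf t (rb_constraint_pmf n d k q)"
  have "(num_solutions n d I)\<^sup>2 = (\<Sum>\<sigma>\<in>rb_assignments n d. \<Sum>\<sigma>'\<in>rb_assignments n d.
      indicator {I. set I \<subseteq> satisfying \<sigma> \<inter> satisfying \<sigma>'} I)" for I
    unfolding num_solutions_def power2_eq_square sum_product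
    by (intro sum.cong refl) (auto simp: indicator_def)
  then have "measure_pmf.expectation ?M (\<lambda>I. (num_solutions n d I)\<^sup>2)
    = (\<Sum>\<sigma>\<in>rb_assignments n d. \<Sum>\<sigma>'\<in>rb_assignments n d.
        measure_pmf.prob ?M {I. set I \<subseteq> satisfying \<sigma> \<inter> satisfying \<sigma>'})"
    by (simp add: Bochner_Integration.integral_sum integrable_indicator_pmf del: le_inf_iff)
  also have "\<dots> = (\<Sum>\<sigma>\<in>rb_assignments n d. \<Sum>\<sigma>'\<in>rb_assignments n d.
        pair_prob n d k q (card (agreement n \<sigma> \<sigma>')) ^ t)"
    unfolding prob_replicate_pmf_subset using assms
    by (intro sum.cong refl) (simp add: prob_satisfying_pair)
  also have "\<dots> = (\<Sum>\<sigma>\<in>rb_assignments n d.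
      (\<Sum>m\<le>n. real (n choose m) * real (d - 1) ^ (n - m) * pair_prob n d k q m ^ t))"
    using sum_over_agreement[of _ n d "\<lambda>m. pair_prob n d k q m ^ t"] by (intro sum.cong) auto
  finally show ?thesis by (simp add: card_rb_assignments)
qed

text \<open>Markov's inequality at level 1 for a variable without values strictly between 0 and 1.
  The bound B serves integrability.\<close>

lemma markov_positive:
  fixes M :: "'a pmf" and X :: "'a \<Rightarrow> real"
  assumes "\<And>x. 0 \<le> X x" "\<And>x. X x \<le> B" "\<And>x. X x > 0 \<Longrightarrow> X x \<ge> 1"
  shows "measure_pmf.prob M {x. X x > 0} \<le> measure_pmf.expectation M X"
proof -
  have "measure_pmf.expectation M (indicator {x. X x > 0}) \<le> measure_pmf.expectation M X"
  proof (rule integral_mono)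
    show "integrable (measure_pmf M) X"
      by (rule measure_pmf.integrable_const_bound[where B = B]) (use assms in auto)
    show "indicator {x. X x > 0} x \<le> X x" for x
      using assms(1,3)[of x] by (auto simp: indicator_def)
  qed (rule integrable_indicator_pmf)
  then show ?thesis by simp
qed

text \<open>A form of the Cauchy-Schwarz bound P(X > 0) \<ge> E[X]^2 / E[X^2], obtained by expanding
  the expectation of a single square.\<close>

lemma second_moment_lower_bound:
  fixes M :: "'a pmf" and X :: "'a \<Rightarrow> real"
  assumes X: "\<And>x. 0 \<le> X x" "\<And>x. X x \<le> B"
    and E: "measure_pmf.expectation M X > 0" and R: "R > 0"
    and le: "measure_pmf.expectation M (\<lambda>x. (X x)\<^sup>2) \<le> R * (measure_pmf.expectation M X)\<^sup>2"
  shows "measure_pmf.prob M {x. X x > 0} \<ge> 1 / R"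
proof -
  define e where "e = measure_pmf.expectation M X"
  define P where "P = measure_pmf.prob M {x. X x > 0}"
  have iX: "integrable (measure_pmf M) X"
    by (rule measure_pmf.integrable_const_bound[where B = B]) (use X in auto)
  have iX2: "integrable (measure_pmf M) (\<lambda>x. (X x)\<^sup>2)"
    by (rule measure_pmf.integrable_const_bound[where B = "B\<^sup>2"]) (use X in \<open>auto intro: power_mono\<close>)
  \<comment> \<open>With this multiplier the expanded expectation is at most R e^2 - 2 R e^2 + R^2
    e^2 P, which factors as R e^2 (R P - 1).\<close>
  let ?l = "R * e"
  have eq: "(X x - ?l * indicator {x. X x > 0} x)\<^sup>2
     = (X x)\<^sup>2 - 2 * ?l * X x + ?l\<^sup>2 * indicator {x. X x > 0} x" for x
    using X(1)[of x] by (auto simp: indicator_def power2_eq_square algebra_simps)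
  have "0 \<le> measure_pmf.expectation M (\<lambda>x. (X x - ?l * indicator {x. X x > 0} x)\<^sup>2)"
    by (rule integral_nonneg_AE) auto
  also have "\<dots> = measure_pmf.expectation M (\<lambda>x. (X x)\<^sup>2) - 2 * ?l * e + ?l\<^sup>2 * P"
    unfolding eq using iX iX2 by (simp add: e_def P_def integrable_indicator_pmf)
  also have "\<dots> \<le> R * e\<^sup>2 - 2 * ?l * e + ?l\<^sup>2 * P" using le by (simp add: e_def)
  also have "\<dots> = (R * e\<^sup>2) * (R * P - 1)" by (simp add: power2_eq_square algebra_simps)
  finally have "0 \<le> (R * e\<^sup>2) * (R * P - 1)" .
  moreover have "R * e\<^sup>2 > 0" using E R by (simp add: e_def)
  ultimately have "R * P - 1 \<ge> 0" using zero_le_mult_iff not_le by blast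
  then show ?thesis using R by (simp add: P_def field_simps)
qed

subsection \<open>Binomial weights and elementary inequalities\<close>

text \<open>Sampling without replacement is less likely to stay inside an m-subset: each factor (m -
  j) / (n - j) is at most m / n. The product form avoids division, and truncated subtraction makes
  the factor 0 once j exceeds m.\<close>

lemma binomial_mult_power_le:
  assumes "m \<le> n"
  shows "(m choose k) * n ^ k \<le> (n choose k) * m ^ k"
proof (induction k)
  case (Suc k)
  have "(m - k) * n \<le> (n - k) * m"
    using assms by (cases "k \<le> m") (auto simp: diff_mult_distrib algebra_simps intro: diff_le_mono2 mult_le_mono)
  then have "((m choose k) * n ^ k) * ((m - k) * n) \<le> ((n choose k) * m ^ k) * ((n - k) * m)"
    using Suc by (rule mult_le_mono[rotated])
  \<comment> \<open>Multiplying by k + 1 turns the step from k to k + 1 into one extra factor (j -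
    k) l; it is instantiated for both sides of the inequality.\<close>
  moreover have "Suc k * ((j choose Suc k) * l ^ Suc k) = ((j choose k) * l ^ k) * ((j - k) * l)" for j l
  proof -
    have absorb: "Suc k * (j choose Suc k) = (j - k) * (j choose k)"
      using binomial_absorption[of k j] binomial_absorb_comp[of j k] by simp
    have "Suc k * ((j choose Suc k) * l ^ Suc k) = (Suc k * (j choose Suc k)) * l ^ Suc k"
      by (simp only: mult.assoc)
    also have "\<dots> = ((j choose k) * l ^ k) * ((j - k) * l)" unfolding absorb by simp
    finally show ?thesis .
  qed
  ultimately have "Suc k * ((m choose Suc k) * n ^ Suc k) \<le> Suc k * ((n choose Suc k) * m ^ Suc k)"
    by presburger
  then show ?case by (metis Suc_mult_le_cancel1)
qed simp

lemma binomial_ratio_le_power: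
  assumes "m \<le> n" "k \<le> n" "n > 0"
  shows "real (m choose k) / real (n choose k) \<le> (real m / real n) ^ k"
proof -
  have "real ((m choose k) * n ^ k) \<le> real ((n choose k) * m ^ k)"
    using binomial_mult_power_le[OF assms(1)] of_nat_le_iff by blast
  moreover have "n choose k > 0" using assms by (simp add: zero_less_binomial_iff)
  ultimately show ?thesis using assms by (simp add: field_simps power_divide)
qed

text \<open>
  The factor \<open>(N P - 1) / (N - 1)\<close> is centred when \<open>m\<close> is binomial with success probability \<open>1/d\<close>;
  estimating \<open>(N - q) (N - q - 1) / (N (N - 1))\<close> by \<open>(1 - q/N)^2\<close> would lose this.
\<close>

lemma pair_prob_eq:
  assumes "real q < real d ^ k" "real d ^ k > 1"
  defines "N \<equiv> real d ^ k"
  shows "pair_prob n d k q m = (1 - real q / N)\<^sup>2 *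
    (1 + real q / (N - real q) * ((N * (real (m choose k) / real (n choose k)) - 1) / (N - 1)))"
proof -
  have "P * (1 - Q / N) + (1 - P) * ((N - Q) * (N - Q - 1) / (N * (N - 1)))
    = (1 - Q / N)\<^sup>2 * (1 + Q / (N - Q) * ((N * P - 1) / (N - 1)))" if "Q < N" "N > 1" for P Q N :: real
    using that by (simp add: divide_simps power2_eq_square) algebra
  then show ?thesis unfolding pair_prob_def Let_def N_def using assms by blast
qed

text \<open>Exponential tilting: for m \<ge> a the factor exp (m - a) is at least 1. Inserting it
  and extending the sum to all m leaves (1 + e b)^n exp (- a).\<close>

lemma sum_binomial_tail_le:
  fixes b a :: real
  assumes "b \<ge> 0"
  shows "(\<Sum>m\<le>n. if a \<le> real m then real (n choose m) * b ^ m else 0) \<le> exp (exp 1 * real n * b - a)"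
proof -
  have "(\<Sum>m\<le>n. if a \<le> real m then real (n choose m) * b ^ m else 0)
    \<le> (\<Sum>m\<le>n. (real (n choose m) * (exp 1 * b) ^ m * 1 ^ (n - m)) * exp (- a))"
  proof (rule sum_mono)
    fix m
    have "real (n choose m) * b ^ m * 1 \<le> real (n choose m) * b ^ m * exp (real m - a)" if "a \<le> real m"
      using that assms by (intro mult_left_mono) auto
    also have "exp (real m - a) = exp 1 ^ m * exp (- a)"
      by (simp add: exp_of_nat_mult[symmetric] exp_add[symmetric])
    finally show "(if a \<le> real m then real (n choose m) * b ^ m else 0)
      \<le> (real (n choose m) * (exp 1 * b) ^ m * 1 ^ (n - m)) * exp (- a)"
      using assms by (auto simp: power_mult_distrib algebra_simps)
  qed
  also have "\<dots> = (exp 1 * b + 1) ^ n * exp (- a)"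
    by (simp add: binomial_ring sum_distrib_right)
  also have "\<dots> \<le> exp (exp 1 * b) ^ n * exp (- a)"
    using assms exp_ge_add_one_self[of "exp 1 * b"]
    by (intro mult_right_mono power_mono) (auto simp: add.commute)
  also have "\<dots> = exp (exp 1 * real n * b - a)"
    by (simp add: exp_of_nat_mult[symmetric] exp_add[symmetric] algebra_simps)
  finally show ?thesis .
qed

text \<open>Here p is the success probability of a binomial law, later 1/d, and not the proportion
  of incompatible tuples.\<close>

definition binom_weight :: "nat \<Rightarrow> real \<Rightarrow> nat \<Rightarrow> real" where
  "binom_weight n p m = real (n choose m) * p ^ m * (1 - p) ^ (n - m)"

lemma binom_weight_nonneg: "0 \<le> p \<Longrightarrow> p \<le> 1 \<Longrightarrow> 0 \<le> binom_weight n p m"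
  by (simp add: binom_weight_def)

lemma sum_binom_weight: "(\<Sum>m\<le>n. binom_weight n p m) = 1"
  using binomial_ring[of p "1 - p" n] by (simp add: binom_weight_def)

text \<open>The tilt exp \<open>\<theta>\<close> joins the success weight in the binomial theorem.
  Subtracting the mean removes the first-order term in \<open>\<theta>\<close>, which the following
  two bounds exploit.\<close>

lemma binom_weight_mgf:
  "(\<Sum>m\<le>n. binom_weight n p m * exp (\<theta> * (real m - real n * p)))
     = (exp (- (\<theta> * p)) * (1 + p * (exp \<theta> - 1))) ^ n"
proof -
  have "(\<Sum>m\<le>n. binom_weight n p m * exp (\<theta> * (real m - real n * p)))
     = (\<Sum>m\<le>n. real (n choose m) * (p * exp \<theta>) ^ m * (1 - p) ^ (n - m)) * exp (- (\<theta> * p)) ^ n"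
    unfolding sum_distrib_right
  proof (rule sum.cong[OF refl])
    fix m
    have "exp (\<theta> * (real m - real n * p)) = exp (real m * \<theta> + real n * (- (\<theta> * p)))"
      by (simp add: algebra_simps)
    also have "\<dots> = exp \<theta> ^ m * exp (- (\<theta> * p)) ^ n"
      by (simp only: exp_add exp_of_nat_mult)
    finally show "binom_weight n p m * exp (\<theta> * (real m - real n * p))
      = real (n choose m) * (p * exp \<theta>) ^ m * (1 - p) ^ (n - m) * exp (- (\<theta> * p)) ^ n"
      by (simp add: binom_weight_def power_mult_distrib algebra_simps)
  qed
  also have "\<dots> = (p * exp \<theta> + (1 - p)) ^ n * exp (- (\<theta> * p)) ^ n"
    by (simp add: binomial_ring)
  also have "\<dots> = (exp (- (\<theta> * p)) * (1 + p * (exp \<theta> - 1))) ^ n"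
    by (simp add: power_mult_distrib[symmetric] algebra_simps)
  finally show ?thesis .
qed

text \<open>Jensen's inequality for one trial, raised to the n-th power. A lower bound is needed
  because this moment enters the expanded square in \<open>binom_weight_positive_part\<close> with a
  minus sign.\<close>

lemma binom_weight_mgf_ge_1:
  assumes "0 \<le> p" "p \<le> 1"
  shows "(\<Sum>m\<le>n. binom_weight n p m * exp (\<theta> * (real m - real n * p))) \<ge> 1"
proof -
  have "exp ((1 - p) * 0 + p * \<theta>) \<le> (1 - p) * exp 0 + p * exp \<theta>"
    using convex_onD[OF exp_convex, of p 0 \<theta>] assms by simp
  then have "exp (- (\<theta> * p)) * exp (\<theta> * p) \<le> exp (- (\<theta> * p)) * (1 + p * (exp \<theta> - 1))"
    by (intro mult_left_mono) (auto simp: algebra_simps)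
  then have "1 \<le> exp (- (\<theta> * p)) * (1 + p * (exp \<theta> - 1))" by (simp add: exp_add[symmetric])
  then show ?thesis unfolding binom_weight_mgf by simp
qed

text \<open>Rests on exp \<open>\<theta>\<close> \<le> 1 + \<open>\<theta>\<close> +
  \<open>\<theta>\<^sup>2\<close> for 0 \<le> \<open>\<theta>\<close> \<le> 1; the linear term
  cancels against the centring.\<close>

lemma binom_weight_mgf_le:
  assumes "0 \<le> p" "p \<le> 1" "0 \<le> \<theta>" "\<theta> \<le> 1"
  shows "(\<Sum>m\<le>n. binom_weight n p m * exp (\<theta> * (real m - real n * p))) \<le> exp (\<theta>\<^sup>2 * (real n * p))"
proof -
  have "1 + p * (exp \<theta> - 1) \<le> exp (p * (exp \<theta> - 1))" by simp
  also have "p * (exp \<theta> - 1) \<le> p * (\<theta> + \<theta>\<^sup>2)"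
    using exp_bound[of \<theta>] assms by (intro mult_left_mono) auto
  finally have "1 + p * (exp \<theta> - 1) \<le> exp (p * (\<theta> + \<theta>\<^sup>2))" by simp
  then have "exp (- (\<theta> * p)) * (1 + p * (exp \<theta> - 1)) \<le> exp (- (\<theta> * p)) * exp (p * (\<theta> + \<theta>\<^sup>2))"
    by (intro mult_left_mono) auto
  also have "\<dots> = exp (\<theta>\<^sup>2 * p)" by (simp add: exp_add[symmetric] algebra_simps)
  finally have "(exp (- (\<theta> * p)) * (1 + p * (exp \<theta> - 1))) ^ n \<le> exp (\<theta>\<^sup>2 * p) ^ n"
    using assms by (intro power_mono) auto
  then show ?thesis unfolding binom_weight_mgf
    by (simp add: exp_of_nat_mult[symmetric] algebra_simps)
qed

text \<open>
  The square avoids the linear term of \<open>exp a - 1\<close>, so that averaging over a centred variable costs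
  only its variance.
\<close>

lemma exp_max_0_le:
  fixes a \<epsilon> :: real
  assumes "\<epsilon> > 0"
  shows "exp (max 0 a) \<le> 1 + \<epsilon> + (exp a - 1)\<^sup>2 / \<epsilon>"
proof (cases "a \<le> 0")
  case False
  define z where "z = exp a - 1"
  have "z * \<epsilon> \<le> \<epsilon>\<^sup>2 + z\<^sup>2"
  proof -
    have "0 \<le> z * \<epsilon>" using assms False by (simp add: z_def)
    then show ?thesis using sum_squares_bound[of z \<epsilon>] by linarith
  qed
  then have "z \<le> \<epsilon> + z\<^sup>2 / \<epsilon>" using assms by (simp add: field_simps power2_eq_square)
  then show ?thesis using False by (simp add: z_def max_def)
qed (use assms in \<open>auto simp: max_def\<close>)

text \<open>With Y = m - n p, the mean of (exp (\<open>\<theta>\<close> Y) - 1)^2 is M(2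
  \<open>\<theta>\<close>) - 2 M(\<open>\<theta>\<close>) + 1 for the centred moment generating
  function M. It is at most w since M(2 \<open>\<theta>\<close>) \<le> 1 + w and
  M(\<open>\<theta>\<close>) \<ge> 1. In \<open>exp_max_0_le\<close> the choice
  \<open>\<epsilon>\<close> = sqrt w balances \<open>\<epsilon>\<close> against w /
  \<open>\<epsilon>\<close>.\<close>

lemma binom_weight_positive_part:
  assumes p: "0 < p" "p \<le> 1" and "n > 0" and \<theta>: "0 < \<theta>" "2 * \<theta> \<le> 1"
  shows "(\<Sum>m\<le>n. binom_weight n p m * exp (\<theta> * max 0 (real m - real n * p)))
    \<le> 1 + 2 * sqrt (exp (4 * \<theta>\<^sup>2 * (real n * p)) - 1)"
proof -
  define w where "w = exp (4 * \<theta>\<^sup>2 * (real n * p)) - 1"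
  have w: "w > 0" using assms by (simp add: w_def)
  define y where "y m = real m - real n * p" for m
  let ?B = "binom_weight n p"
  have expand: "b * (1 + e + (x - 2 * y + 1) / e) = (1 + e) * b + (b * x - 2 * (b * y) + b) / e"
    for b e x y :: real
    by (simp add: algebra_simps add_divide_distrib diff_divide_distrib)
  have "(\<Sum>m\<le>n. ?B m * exp (\<theta> * max 0 (y m)))
      \<le> (\<Sum>m\<le>n. ?B m * (1 + sqrt w + (exp (\<theta> * y m) - 1)\<^sup>2 / sqrt w))"
  proof (rule sum_mono, rule mult_left_mono)
    fix m
    have "\<theta> * max 0 (y m) = max 0 (\<theta> * y m)" using \<theta> by (simp add: max_mult_distrib_left)
    then show "exp (\<theta> * max 0 (y m)) \<le> 1 + sqrt w + (exp (\<theta> * y m) - 1)\<^sup>2 / sqrt w"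
      using exp_max_0_le[of "sqrt w" "\<theta> * y m"] w by simp
  qed (use p in \<open>simp add: binom_weight_nonneg\<close>)
  also have "\<dots> = (\<Sum>m\<le>n. (1 + sqrt w) * ?B m + (?B m * exp (2 * \<theta> * y m) - 2 * (?B m * exp (\<theta> * y m)) + ?B m) / sqrt w)"
  proof (rule sum.cong[OF refl])
    fix m
    have "(exp (\<theta> * y m) - 1)\<^sup>2 = exp (2 * \<theta> * y m) - 2 * exp (\<theta> * y m) + 1"
      by (simp add: power2_eq_square algebra_simps exp_add[symmetric])
    then show "?B m * (1 + sqrt w + (exp (\<theta> * y m) - 1)\<^sup>2 / sqrt w) =
      (1 + sqrt w) * ?B m + (?B m * exp (2 * \<theta> * y m) - 2 * (?B m * exp (\<theta> * y m)) + ?B m) / sqrt w"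
      using expand[of "?B m" "sqrt w"] by (simp only:)
  qed
  also have "\<dots> = (1 + sqrt w) + ((\<Sum>m\<le>n. ?B m * exp (2 * \<theta> * y m)) - 2 * (\<Sum>m\<le>n. ?B m * exp (\<theta> * y m)) + 1) / sqrt w"
    by (simp add: sum.distrib sum_subtractf sum_distrib_left[symmetric] sum_divide_distrib[symmetric] sum_binom_weight)
  also have "\<dots> \<le> (1 + sqrt w) + (exp ((2 * \<theta>)\<^sup>2 * (real n * p)) - 2 * 1 + 1) / sqrt w"
    using binom_weight_mgf_le[of p "2 * \<theta>" n] binom_weight_mgf_ge_1[of p n \<theta>] p \<theta> w
    by (intro add_left_mono divide_right_mono) (auto simp: y_def)
  also have "(exp ((2 * \<theta>)\<^sup>2 * (real n * p)) - 2 * 1 + 1) / sqrt w = sqrt w"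
    using w by (simp add: w_def power_mult_distrib real_div_sqrt)
  finally show ?thesis by (simp add: y_def w_def)
qed

text \<open>The derivative is (x - ln (1 + x)) / x^2. This transfers the lower bound on k, stated at
  c, to every smaller v.\<close>

lemma entropy_ratio_mono:
  fixes v c :: real
  assumes "0 < v" "v \<le> c"
  shows "(1 + v) * ln (1 + v) / v \<le> (1 + c) * ln (1 + c) / c"
proof (rule DERIV_nonneg_imp_nondecreasing[of v c "\<lambda>x. (1 + x) * ln (1 + x) / x", OF assms(2)])
  fix x assume "v \<le> x" "x \<le> c"
  then have x: "x > 0" using assms by simp
  have "((\<lambda>x. (1 + x) * ln (1 + x) / x) has_real_derivative
      ((ln (1 + x) + 1) * x - (1 + x) * ln (1 + x)) / (x * x)) (at x)"
    using x by (auto intro!: derivative_eq_intros)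
  then have "((\<lambda>x. (1 + x) * ln (1 + x) / x) has_real_derivative (x - ln (1 + x)) / x\<^sup>2) (at x)"
    by (simp add: algebra_simps power2_eq_square)
  moreover have "(x - ln (1 + x)) / x\<^sup>2 \<ge> 0" using x ln_add_one_self_le_self[of x] by simp
  ultimately show "\<exists>y. ((\<lambda>x. (1 + x) * ln (1 + x) / x) has_real_derivative y) (at x) \<and> y \<ge> 0"
    by blast
qed

text \<open>The quotient ln (1 + c x^k) / x is nondecreasing on (0, 1]: with v = c x^k its
  derivative has the sign of k v / (1 + v) - ln (1 + v). For c = \<open>\<tau>\<close> - 1 the
  hypothesis on k is the one of the theorem, k \<ge> \<open>\<tau>\<close> ln \<open>\<tau>\<close>
  / (\<open>\<tau>\<close> - 1).\<close>

lemma ln_one_plus_power_le: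
  fixes s c :: real
  assumes c: "c > 0" and k: "real k \<ge> (1 + c) * ln (1 + c) / c" "k > 0" and s: "0 < s" "s \<le> 1"
  shows "ln (1 + c * s ^ k) \<le> s * ln (1 + c)"
proof -
  have "ln (1 + c * s ^ k) / s \<le> ln (1 + c * 1 ^ k) / 1"
  proof (rule DERIV_nonneg_imp_nondecreasing[of s 1 "\<lambda>x. ln (1 + c * x ^ k) / x", OF s(2)])
    fix x assume "s \<le> x" "x \<le> 1"
    then have x: "x > 0" "x \<le> 1" using s by auto
    define v where "v = c * x ^ k"
    have v: "v > 0" "v \<le> c" using x c by (auto simp: v_def power_le_one)
    have pos: "1 + c * x ^ k > 0" using v by (simp add: v_def)
    have "(1 + v) * ln (1 + v) / v \<le> real k" using entropy_ratio_mono[OF v] k by simp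
    then have "ln (1 + v) \<le> real k * v / (1 + v)" using v by (simp add: field_simps)
    then have "(real k * v / (1 + v) - ln (1 + v)) / x\<^sup>2 \<ge> 0" by simp
    moreover have "((\<lambda>x. ln (1 + c * x ^ k) / x) has_real_derivative
        (real k * v / (1 + v) - ln (1 + v)) / x\<^sup>2) (at x)"
    proof -
      have "((\<lambda>x. ln (1 + c * x ^ k) / x) has_real_derivative
          (c * (real k * x ^ (k - 1)) / (1 + c * x ^ k) * x - ln (1 + c * x ^ k)) / (x * x)) (at x)"
        using x pos by (auto intro!: derivative_eq_intros)
      moreover have "x ^ (k - 1) * x = x ^ k" using k(2) by (metis power_minus_mult)
      then have "c * (real k * x ^ (k - 1)) / (1 + c * x ^ k) * x = real k * v / (1 + v)"
        by (simp add: v_def mult_ac)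
      ultimately show ?thesis by (simp only: v_def power2_eq_square)
    qed
    ultimately show "\<exists>y. ((\<lambda>x. ln (1 + c * x ^ k) / x) has_real_derivative y) (at x) \<and> y \<ge> 0"
      by blast
  qed
  then show ?thesis using s by (simp add: field_simps)
qed

text \<open>Factors out x - 1 and bounds the geometric sum. It makes the exponent linear in the
  overlap, so that a moment generating function applies.\<close>

lemma power_minus_one_le:
  fixes x u :: real
  assumes "1 \<le> x" "x \<le> u"
  shows "x ^ k - 1 \<le> real k * u ^ (k - 1) * (x - 1)"
proof -
  have "(\<Sum>i<k. x ^ i) \<le> (\<Sum>i<k. u ^ (k - 1))"
  proof (rule sum_mono)
    fix i assume "i \<in> {..<k}"
    then have "x ^ i \<le> x ^ (k - 1)" using assms by (intro power_increasing) auto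
    also have "\<dots> \<le> u ^ (k - 1)" using assms by (intro power_mono) auto
    finally show "x ^ i \<le> u ^ (k - 1)" .
  qed
  then have "(x - 1) * (\<Sum>i<k. x ^ i) \<le> (x - 1) * (real k * u ^ (k - 1))"
    using assms by (intro mult_left_mono) auto
  then show ?thesis by (simp add: power_diff_1_eq algebra_simps)
qed

subsection \<open>Bounding the normalized second moment\<close>

text \<open>
  Overlaps \<open>m \<le> m1\<close> are compared with a centred exponential moment. For \<open>m1 \<le> m \<le> m2\<close> the factor
  is at most \<open>exp m\<close>, since \<open>(m/n)^k\<close> is of smaller order than \<open>m/n\<close>. For \<open>m \<ge> m2\<close> it is at most
  \<open>d^((1 - \<delta>) m)\<close>, which the probability \<open>d^(- m)\<close> of agreement beats.
\<close>

lemma normalized_second_moment_le: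
  fixes n d k t :: nat and r c c' \<delta> L :: real
  defines "N \<equiv> real d ^ k"
  defines "P \<equiv> (\<lambda>m. real (m choose k) / real (n choose k))"
  defines "m1 \<equiv> 8 * (real n / real d) + L"
  defines "m2 \<equiv> 3 * (real n * real d powr (- \<delta>)) + L"
  defines "\<theta> \<equiv> 2 * r * c * real k * ln (real d) * (m1 / real n) ^ (k - 1)"
  assumes d: "d \<ge> 2" and k: "k \<ge> 2" "k \<le> n" and c': "0 \<le> c'" "c' \<le> c" "c' \<le> N - 1" and c: "c > 0"
    and r: "r > 0" and t: "real t \<le> r * real n * ln (real d)"
    and \<delta>: "\<delta> = 1 - r * ln (1 + c)"
    and kc: "real k \<ge> (1 + c) * ln (1 + c) / c"
    and L: "L \<ge> 0"
    and \<eta>: "r * c * ln (real d) * (m2 / real n) ^ (k - 1) \<le> 1"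
    and \<theta>1: "2 * \<theta> \<le> 1"
  shows "(\<Sum>m\<le>n. binom_weight n (1 / real d) m * (1 + c' * ((N * P m - 1) / (N - 1))) ^ t)
     \<le> 1 + 2 * sqrt (exp (4 * \<theta>\<^sup>2 * (real n / real d)) - 1) + 2 * exp (- L)"
proof -
  let ?D = "real d" and ?n = "real n"
  have D: "?D \<ge> 2" using d by simp
  have n: "?n > 0" using k by simp
  have lnD: "ln ?D > 0" using D by simp
  have "?D ^ 1 \<le> N" unfolding N_def using D k by (intro power_increasing) auto
  then have N: "N \<ge> 2" using D by simp
  have m1: "m1 > 0" unfolding m1_def using L n D by (simp add: add_pos_nonneg)
  have \<theta>: "\<theta> > 0" unfolding \<theta>_def using r c k lnD m1 n by simp
  define f where "f m = (1 + c' * ((N * P m - 1) / (N - 1))) ^ t" for m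
  have P: "0 \<le> P m" "P m \<le> (real m / ?n) ^ k" "(real m / ?n) ^ k \<le> 1" if "m \<le> n" for m
    using binomial_ratio_le_power[OF that k(2)] n that by (auto simp: P_def power_le_one)
  \<comment> \<open>The worst case is P m = 0, with value 1 - c' / (N - 1). Nonnegativity is what
    allows upper bounds on the base to be raised to the power t.\<close>
  have base: "0 \<le> 1 + c' * ((N * P m - 1) / (N - 1))" if "m \<le> n" for m
  proof -
    have "c' * (- 1 / (N - 1)) \<le> c' * ((N * P m - 1) / (N - 1))"
      using P(1)[OF that] N c' by (intro mult_left_mono divide_right_mono) auto
    moreover have "c' / (N - 1) \<le> 1" using c' N by simp
    ultimately show ?thesis by simp
  qed
  \<comment> \<open>Gives up the centring, by (N P - 1) / (N - 1) \<le> P for P \<le> 1. Only the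
    middle and large overlaps use this bound.\<close>
  have f_le: "f m \<le> exp (real t * ln (1 + c * (real m / ?n) ^ k))" if m: "m \<le> n" for m
  proof -
    have pos: "1 + c * (real m / ?n) ^ k > 0" using c by (simp add: add_pos_nonneg)
    have "(N * P m - 1) / (N - 1) \<le> (real m / ?n) ^ k"
    proof -
      have "N * P m - 1 \<le> P m * (N - 1)" using P[OF m] by (simp add: algebra_simps)
      then have "(N * P m - 1) / (N - 1) \<le> P m" using N by (simp add: pos_divide_le_eq)
      then show ?thesis using P[OF m] by simp
    qed
    then have "c' * ((N * P m - 1) / (N - 1)) \<le> c' * (real m / ?n) ^ k"
      using c' by (intro mult_left_mono)
    also have "\<dots> \<le> c * (real m / ?n) ^ k" using c' by (intro mult_right_mono) auto
    finally have "f m \<le> (1 + c * (real m / ?n) ^ k) ^ t"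
      unfolding f_def using base[OF m] by (intro power_mono) auto
    also have "\<dots> = exp (real t * ln (1 + c * (real m / ?n) ^ k))"
      using pos by (simp add: exp_of_nat_mult)
    finally show ?thesis .
  qed
  have p01: "0 < 1 / ?D" "1 / ?D \<le> 1" using D by auto
  have weight: "binom_weight n (1 / ?D) m \<le> real (n choose m) * (1 / ?D) ^ m" for m
    unfolding binom_weight_def using p01
    by (intro mult_left_le) (auto intro!: power_le_one)
  have small: "f m \<le> exp (\<theta> * max 0 (real m - ?n * (1 / ?D)))" if m: "m \<le> n" "real m \<le> m1" for m
  proof -
    let ?y = "c' * ((N * P m - 1) / (N - 1))"
    have "f m \<le> exp ?y ^ t" unfolding f_def using base[OF m(1)] by (intro power_mono) auto
    also have "\<dots> = exp (real t * ?y)" by (simp only: exp_of_nat_mult)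
    also have "real t * ?y \<le> \<theta> * max 0 (real m - ?n * (1 / ?D))"
    proof (cases "N * P m \<le> 1")
      case True
      then have "?y \<le> 0" using c' N by (simp add: mult_nonneg_nonpos divide_nonpos_nonneg)
      then have "real t * ?y \<le> 0" by (rule mult_nonneg_nonpos[OF of_nat_0_le_iff])
      also have "0 \<le> \<theta> * max 0 (real m - ?n * (1 / ?D))" using \<theta> by simp
      finally show ?thesis .
    next
      case False
      \<comment> \<open>The overlap relative to its mean n/d; u is its value at the cut-off m1. In
        these units N (m/n)^k is simply x^k.\<close>
      define x where "x = real m * ?D / ?n"
      define u where "u = m1 * ?D / ?n"
      have xk: "N * (real m / ?n) ^ k = x ^ k" by (simp add: N_def x_def power_mult_distrib power_divide)
      have le: "N * P m \<le> x ^ k" unfolding xk[symmetric] using P[OF m(1)] N by (intro mult_left_mono) auto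
      then have "1 < x ^ k" using False by simp
      then have x1: "1 < x" using power_le_one[of x k] n by (force simp: x_def not_less)
      have xu: "x \<le> u" unfolding x_def u_def using m n by (intro divide_right_mono mult_right_mono) auto
      have A: "x ^ k - 1 \<le> real k * u ^ (k - 1) * (x - 1)" using power_minus_one_le[of x u k] x1 xu by simp
      \<comment> \<open>Replacing N - 1 by N/2 is the source of the factor 2 in
        \<open>\<theta>\<close>.\<close>
      have "N - 1 \<ge> N / 2" using N by simp
      then have B: "1 / (N - 1) \<le> 2 / N" using N by (simp add: field_simps)
      have "?y \<le> c * ((x ^ k - 1) * (1 / (N - 1)))"
        using c' N le False by (intro mult_mono) (auto intro!: divide_right_mono)
      also have "\<dots> \<le> c * ((real k * u ^ (k - 1) * (x - 1)) * (2 / N))"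
        using A B c N x1 \<open>1 < x ^ k\<close> xu by (intro mult_left_mono[of _ _ c] mult_mono) auto
      finally have y_le: "?y \<le> c * ((real k * u ^ (k - 1) * (x - 1)) * (2 / N))" .
      have "0 \<le> ?y" using c' N False by simp
      then have "real t * ?y \<le> (r * ?n * ln ?D) * (c * ((real k * u ^ (k - 1) * (x - 1)) * (2 / N)))"
        using r n lnD by (intro mult_mono[OF t y_le]) simp_all
      also have "\<dots> = 2 * r * c * real k * ln ?D * (u ^ (k - 1) * ?D / N) * (?n * (x - 1) / ?D)"
        using D by simp
      also have "?n * (x - 1) / ?D = real m - ?n * (1 / ?D)"
        using n D by (simp add: x_def field_simps)
      also have "u ^ (k - 1) * ?D / N = (m1 / ?n) ^ (k - 1)"
      proof -
        have "N = ?D ^ (k - 1) * ?D" unfolding N_def using k power_minus_mult[of k ?D] by simp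
        then show ?thesis using D n by (simp add: u_def power_mult_distrib power_divide)
      qed
      also have "2 * r * c * real k * ln ?D * (m1 / ?n) ^ (k - 1) = \<theta>" by (simp add: \<theta>_def)
      also have "\<theta> * (real m - ?n * (1 / ?D)) \<le> \<theta> * max 0 (real m - ?n * (1 / ?D))"
        using \<theta> by (intro mult_left_mono) auto
      finally show ?thesis .
    qed
    finally show ?thesis by simp
  qed
  have middle: "f m \<le> exp 1 ^ m" if m: "m \<le> n" "real m \<le> m2" for m
  proof -
    have "ln (1 + c * (real m / ?n) ^ k) \<le> c * (real m / ?n) ^ k"
      using c by (intro ln_add_one_self_le_self) simp
    then have "real t * ln (1 + c * (real m / ?n) ^ k) \<le> (r * ?n * ln ?D) * (c * (real m / ?n) ^ k)"
      using t c lnD r n by (intro mult_mono) auto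
    also have "\<dots> = (r * c * ln ?D * (real m / ?n) ^ (k - 1)) * real m"
    proof -
      have "(real m / ?n) ^ k * ?n = (real m / ?n) ^ (k - 1) * real m"
        using k n power_minus_mult[of k "real m / ?n"] by (simp add: field_simps)
      then show ?thesis by (metis (no_types, opaque_lifting) mult.assoc mult.commute)
    qed
    also have "\<dots> \<le> (r * c * ln ?D * (m2 / ?n) ^ (k - 1)) * real m"
      using m n r c lnD by (intro mult_right_mono mult_left_mono power_mono divide_right_mono) auto
    also have "\<dots> \<le> 1 * real m" using \<eta> by (intro mult_right_mono) auto
    finally have "exp (real t * ln (1 + c * (real m / ?n) ^ k)) \<le> exp (real m)" by simp
    with f_le[OF m(1)] have "f m \<le> exp (real m)" by (rule order_trans)
    then show ?thesis using exp_of_nat_mult[of m "1 :: real"] by simp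
  qed
  have large: "f m \<le> (?D powr (1 - \<delta>)) ^ m" if m: "m \<le> n" for m
  proof -
    have "ln (1 + c * (real m / ?n) ^ k) \<le> (real m / ?n) * ln (1 + c)"
    proof (cases "m = 0")
      case False
      then have "0 < real m / ?n" "real m / ?n \<le> 1" using m n by auto
      then show ?thesis using ln_one_plus_power_le[OF c kc, of "real m / ?n"] k by simp
    qed (use k in \<open>simp add: power_0_left\<close>)
    then have "real t * ln (1 + c * (real m / ?n) ^ k) \<le> (r * ?n * ln ?D) * ((real m / ?n) * ln (1 + c))"
      using t c lnD r n by (intro mult_mono) auto
    also have "\<dots> = real m * ((1 - \<delta>) * ln ?D)" using n by (simp add: \<delta>)
    finally have "exp (real t * ln (1 + c * (real m / ?n) ^ k)) \<le> exp (real m * ((1 - \<delta>) * ln ?D))"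
      by (simp only: exp_le_cancel_iff)
    also have "\<dots> = (?D powr (1 - \<delta>)) ^ m" using D by (simp only: exp_of_nat_mult) (simp add: powr_def)
    finally have "exp (real t * ln (1 + c * (real m / ?n) ^ k)) \<le> (?D powr (1 - \<delta>)) ^ m" .
    with f_le[OF m] show ?thesis by (rule order_trans)
  qed
  let ?w = "binom_weight n (1 / ?D)"
  \<comment> \<open>Every m falls under one of the three bounds, and all summands are nonnegative,
    so the bounds may be added. If m2 < m1, the middle range is just empty.\<close>
  have "(\<Sum>m\<le>n. ?w m * f m) \<le> (\<Sum>m\<le>n. ?w m * exp (\<theta> * max 0 (real m - ?n * (1 / ?D)))
     + (if m1 \<le> real m then real (n choose m) * (exp 1 / ?D) ^ m else 0)
     + (if m2 \<le> real m then real (n choose m) * (?D powr (- \<delta>)) ^ m else 0))"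
  proof (rule sum_mono)
    fix m assume "m \<in> {..n}"
    then have m: "m \<le> n" by simp
    have w0: "?w m \<ge> 0" using p01 by (simp add: binom_weight_nonneg)
    have f0: "f m \<ge> 0" unfolding f_def using base[OF m] by simp
    define X where "X = ?w m * exp (\<theta> * max 0 (real m - ?n * (1 / ?D)))"
    define Y where "Y = real (n choose m) * (exp 1 / ?D) ^ m"
    define Z where "Z = real (n choose m) * (?D powr (- \<delta>)) ^ m"
    have nonneg: "X \<ge> 0" "Y \<ge> 0" "Z \<ge> 0" unfolding X_def Y_def Z_def using w0 D by auto
    have "?w m * f m \<le> X" if "real m \<le> m1"
      unfolding X_def using small[OF m that] w0 by (intro mult_left_mono)
    moreover have "?w m * f m \<le> Y" if "real m \<le> m2"
    proof -
      have "?w m * f m \<le> (real (n choose m) * (1 / ?D) ^ m) * exp 1 ^ m"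
        using middle[OF m that] weight f0 p01 by (intro mult_mono) auto
      then show ?thesis by (simp add: Y_def power_divide)
    qed
    moreover have "?w m * f m \<le> Z"
    proof -
      have "?w m * f m \<le> (real (n choose m) * (1 / ?D) ^ m) * (?D powr (1 - \<delta>)) ^ m"
        using large[OF m] weight f0 p01 by (intro mult_mono) auto
      also have "\<dots> = real (n choose m) * ((1 / ?D) * ?D powr (1 - \<delta>)) ^ m"
        by (simp only: power_mult_distrib mult.assoc)
      also have "(1 / ?D) * ?D powr (1 - \<delta>) = ?D powr (- \<delta>)"
        using D by (simp add: powr_diff powr_minus field_simps)
      finally show ?thesis by (simp add: Z_def)
    qed
    ultimately have "?w m * f m \<le> X + (if m1 \<le> real m then Y else 0) + (if m2 \<le> real m then Z else 0)"
      using nonneg by (cases "real m \<le> m1"; cases "real m \<le> m2") (auto intro: order_trans)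
    then show "?w m * f m \<le> ?w m * exp (\<theta> * max 0 (real m - ?n * (1 / ?D)))
     + (if m1 \<le> real m then real (n choose m) * (exp 1 / ?D) ^ m else 0)
     + (if m2 \<le> real m then real (n choose m) * (?D powr (- \<delta>)) ^ m else 0)"
      by (simp only: X_def Y_def Z_def)
  qed
  also have "\<dots> \<le> (1 + 2 * sqrt (exp (4 * \<theta>\<^sup>2 * (?n * (1 / ?D))) - 1))
      + exp (exp 1 * ?n * (exp 1 / ?D) - m1) + exp (exp 1 * ?n * (?D powr (- \<delta>)) - m2)"
    unfolding sum.distrib using p01 n \<theta> \<theta>1 D
    by (intro add_mono binom_weight_positive_part sum_binomial_tail_le) auto
  also have "\<dots> \<le> (1 + 2 * sqrt (exp (4 * \<theta>\<^sup>2 * (?n * (1 / ?D))) - 1)) + exp (- L) + exp (- L)"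
  proof -
    \<comment> \<open>The constants 8 in m1 and 3 in m2 dominate e^2 and e, the coefficients
      produced by \<open>sum_binomial_tail_le\<close> for the two tails; what remains in each
      exponent is at most - L.\<close>
    have e: "exp (1::real) \<le> 2.8" using e_less_272 by simp
    have "exp 1 * exp 1 \<le> 2.8 * (2.8::real)" using e by (intro mult_mono) auto
    then have "(exp 1 * exp 1) * (?n / ?D) \<le> 8 * (?n / ?D)" using n D by (intro mult_right_mono) auto
    moreover have "exp 1 * (?n * ?D powr (- \<delta>)) \<le> 3 * (?n * ?D powr (- \<delta>))"
      using e n by (intro mult_right_mono) auto
    ultimately show ?thesis unfolding m1_def m2_def by (intro add_mono) (auto simp: mult_ac)
  qed
  finally show ?thesis by (simp add: f_def)
qed

subsection \<open>Satisfiability probability for fixed n\<close>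

lemma rb_num_incompat_bounds:
  fixes p :: real and d k :: nat
  assumes "0 < p" "p < 1" "d \<ge> 1"
  defines "N \<equiv> real d ^ k" and "q \<equiv> rb_num_incompat d k p"
  shows "real q \<le> p * N" "real q \<ge> p * N - 1" "q < d ^ k"
proof -
  have N: "N > 0" using assms by (simp add: N_def)
  then have "p * N \<ge> 0" using assms by simp
  then show "real q \<le> p * N" "real q \<ge> p * N - 1"
    unfolding q_def rb_num_incompat_def N_def by linarith+
  have "p * N < 1 * N" using N assms(2) by (intro mult_strict_right_mono)
  with \<open>real q \<le> p * N\<close> have "real q < N" by simp
  then show "q < d ^ k" unfolding N_def by (metis of_nat_less_iff of_nat_power)
qed

lemma rb_num_constraints_bounds:
  assumes "r > 0" "rb_dom_size n \<alpha> \<ge> 1"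
  shows "real (rb_num_constraints n \<alpha> r) \<le> r * real n * ln (real (rb_dom_size n \<alpha>))"
    "real (rb_num_constraints n \<alpha> r) \<ge> r * real n * ln (real (rb_dom_size n \<alpha>)) - 1"
proof -
  have "r * real n * ln (real (rb_dom_size n \<alpha>)) \<ge> 0" using assms by simp
  then show "real (rb_num_constraints n \<alpha> r) \<le> r * real n * ln (real (rb_dom_size n \<alpha>))"
    "real (rb_num_constraints n \<alpha> r) \<ge> r * real n * ln (real (rb_dom_size n \<alpha>)) - 1"
    unfolding rb_num_constraints_def by linarith+
qed

lemma rb_dom_size_le: "real (rb_dom_size n \<alpha>) \<le> real n powr \<alpha>"
  unfolding rb_dom_size_def using powr_ge_zero[of "real n" \<alpha>] by linarith

lemma rb_dom_size_ge:
  assumes "real n powr \<alpha> \<ge> 2"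
  shows "real (rb_dom_size n \<alpha>) \<ge> real n powr \<alpha> / 2" "rb_dom_size n \<alpha> \<ge> 2"
proof -
  show "real (rb_dom_size n \<alpha>) \<ge> real n powr \<alpha> / 2"
    unfolding rb_dom_size_def using assms by linarith
  show "rb_dom_size n \<alpha> \<ge> 2"
    unfolding rb_dom_size_def using assms by linarith
qed

lemma eventually_powr_ge_2:
  assumes "\<alpha> > 0"
  shows "eventually (\<lambda>n. real n powr \<alpha> \<ge> 2) sequentially"
proof -
  have "filterlim (\<lambda>n. real n powr \<alpha>) at_top sequentially" using assms by real_asymp
  then show ?thesis by (simp add: filterlim_at_top)
qed

lemma num_solutions_bounds:
  "0 \<le> num_solutions n d I" "num_solutions n d I \<le> real (card (rb_assignments n d))"
proof -
  show "0 \<le> num_solutions n d I" unfolding num_solutions_def by (intro sum_nonneg) simp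
  show "num_solutions n d I \<le> real (card (rb_assignments n d))"
    unfolding num_solutions_def real_of_card by (intro sum_mono) (rule indicator_le_1)
qed

lemma rb_prob_sat_eq:
  "rb_prob_sat n \<alpha> r k p = measure_pmf.prob
     (replicate_pmf (rb_num_constraints n \<alpha> r)
       (rb_constraint_pmf n (rb_dom_size n \<alpha>) k (rb_num_incompat (rb_dom_size n \<alpha>) k p)))
     {I. num_solutions n (rb_dom_size n \<alpha>) I > 0}"
  unfolding rb_prob_sat_def rb_instance_pmf_def Let_def rb_num_solutions_eq[symmetric] by simp

lemma rb_prob_sat_le:
  fixes n k :: nat and \<alpha> r p :: real
  assumes "k \<le> n" "rb_dom_size n \<alpha> \<ge> 1" "0 < p" "p < 1"
  defines "d \<equiv> rb_dom_size n \<alpha>"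
  shows "rb_prob_sat n \<alpha> r k p
    \<le> real d ^ n * (1 - real (rb_num_incompat d k p) / real d ^ k) ^ rb_num_constraints n \<alpha> r"
proof -
  have "rb_prob_sat n \<alpha> r k p \<le> measure_pmf.expectation
     (replicate_pmf (rb_num_constraints n \<alpha> r) (rb_constraint_pmf n d k (rb_num_incompat d k p)))
     (num_solutions n d)"
    unfolding rb_prob_sat_eq d_def
  proof (rule markov_positive)
    fix I assume "0 < num_solutions n (rb_dom_size n \<alpha>) I"
    then show "1 \<le> num_solutions n (rb_dom_size n \<alpha>) I"
      unfolding rb_num_solutions_eq[symmetric] by simp
  qed (rule num_solutions_bounds)+
  also have "\<dots> = real d ^ n * (1 - real (rb_num_incompat d k p) / real d ^ k) ^ rb_num_constraints n \<alpha> r"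
    using rb_num_incompat_bounds(3)[of p d k] assms
    by (intro expectation_num_solutions) (auto simp: d_def)
  finally show ?thesis .
qed

lemma rb_prob_sat_ge:
  fixes k n :: nat and \<alpha> r p L :: real
  defines "d \<equiv> rb_dom_size n \<alpha>"
  defines "c \<equiv> 1 / (1 - p) - 1"
  defines "\<delta> \<equiv> 1 - r * ln (1 / (1 - p))"
  defines "\<theta> \<equiv> 2 * r * c * real k * ln (real d) * ((8 * (real n / real d) + L) / real n) ^ (k - 1)"
  assumes k: "k \<ge> 2" "k \<le> n" and d: "d \<ge> 2" and p: "0 < p" "p < 1" and r: "r > 0"
    and kc: "real k \<ge> (1 / (1 - p)) * ln (1 / (1 - p)) / (1 / (1 - p) - 1)"
    and L: "L \<ge> 0"
    and \<eta>: "r * c * ln (real d) * ((3 * (real n * real d powr (- \<delta>)) + L) / real n) ^ (k - 1) \<le> 1"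
    and \<theta>: "2 * \<theta> \<le> 1"
  shows "rb_prob_sat n \<alpha> r k p
    \<ge> 1 / (1 + 2 * sqrt (exp (4 * \<theta>\<^sup>2 * (real n / real d)) - 1) + 2 * exp (- L))"
proof -
  define q where "q = rb_num_incompat d k p"
  define t where "t = rb_num_constraints n \<alpha> r"
  define N where "N = real d ^ k"
  define c' where "c' = real q / (N - real q)"
  define M where "M = replicate_pmf t (rb_constraint_pmf n d k q)"
  define R where "R = 1 + 2 * sqrt (exp (4 * \<theta>\<^sup>2 * (real n / real d)) - 1) + 2 * exp (- L)"
  have q: "real q \<le> p * N" "q < d ^ k"
    using rb_num_incompat_bounds[of p d k] p d by (auto simp: q_def N_def)
  have qN: "real q < N" "real q \<le> N - 1"
    using q(2) unfolding N_def by (metis of_nat_less_iff of_nat_power, metis Suc_leI le_diff_eq of_nat_Suc of_nat_le_iff of_nat_power add.commute)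
  have N1: "N > 1" unfolding N_def using d k by (intro one_less_power) auto
  have c: "c > 0" using p by (simp add: c_def field_simps)
  \<comment> \<open>The unrounded number q = p N would give exactly p / (1 - p) = c, and rounding q
    down only lowers q / (N - q).\<close>
  have "c' \<le> c"
  proof -
    have "real q * (1 - p) \<le> p * (N - real q)" using q(1) by (simp add: algebra_simps)
    moreover have "c = p / (1 - p)" using p by (simp add: c_def field_simps)
    moreover have "real q / (N - real q) \<le> p / (1 - p) \<longleftrightarrow> real q * (1 - p) \<le> p * (N - real q)"
      using p qN by (simp add: pos_divide_le_eq pos_le_divide_eq)
    ultimately show ?thesis by (simp only: c'_def)
  qed
  \<comment> \<open>N - q is a positive integer, hence at least 1, so c' \<le> q \<le> N -
    1.\<close>
  moreover have "c' \<le> N - 1"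
  proof -
    have "real q / (N - real q) \<le> real q / 1" using qN by (intro divide_left_mono) auto
    then show ?thesis using qN by (simp add: c'_def)
  qed
  moreover have "0 \<le> c'" using qN by (simp add: c'_def)
  moreover have "real t \<le> r * real n * ln (real d)"
    unfolding t_def d_def using d r by (intro rb_num_constraints_bounds) (auto simp: d_def)
  ultimately have bound: "(\<Sum>m\<le>n. binom_weight n (1 / real d) m *
      (1 + c' * ((N * (real (m choose k) / real (n choose k)) - 1) / (N - 1))) ^ t) \<le> R"
    unfolding R_def N_def \<theta>_def
    using d k c r L \<eta> \<theta> kc
    by (intro normalized_second_moment_le[where c = c and \<delta> = \<delta> and r = r]) (auto simp: \<theta>_def c_def \<delta>_def N_def)
  define e where "e = real d ^ n * (1 - real q / N) ^ t"
  have Ee: "measure_pmf.expectation M (num_solutions n d) = e"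
    unfolding M_def e_def N_def using k q d by (intro expectation_num_solutions) auto
  have e: "e > 0" unfolding e_def using d qN by simp
  have "measure_pmf.expectation M (\<lambda>I. (num_solutions n d I)\<^sup>2)
    = real d ^ n * (\<Sum>m\<le>n. real (n choose m) * real (d - 1) ^ (n - m) * pair_prob n d k q m ^ t)"
    unfolding M_def using k q d by (intro expectation_num_solutions_sq) auto
  also have "\<dots> = real d ^ n * (\<Sum>m\<le>n. (real d ^ n * (1 - real q / N) ^ (2 * t)) * (binom_weight n (1 / real d) m *
      (1 + c' * ((N * (real (m choose k) / real (n choose k)) - 1) / (N - 1))) ^ t))"
  proof (intro arg_cong[where f = "(*) (real d ^ n)"] sum.cong refl)
    fix m assume "m \<in> {..n}"
    then have m: "m \<le> n" by simp
    \<comment> \<open>Converts the counts of pairs into binomial probabilities. The factors d^n and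
      (1 - q/N)^(2t) released here combine with the outer d^n to e^2.\<close>
    have "real d ^ n * ((1 / real d) ^ m * (1 - 1 / real d) ^ (n - m))
       = (real d * (1 / real d)) ^ m * (real d * (1 - 1 / real d)) ^ (n - m)"
      unfolding power_mult_distrib using power_add[of "real d" m "n - m"] m by simp
    also have "\<dots> = real (d - 1) ^ (n - m)" using d by (simp add: right_diff_distrib of_nat_diff)
    finally have w: "real d ^ n * ((1 / real d) ^ m * (1 - 1 / real d) ^ (n - m)) = real (d - 1) ^ (n - m)" .
    have pp: "pair_prob n d k q m ^ t = (1 - real q / N) ^ (2 * t) *
      (1 + c' * ((N * (real (m choose k) / real (n choose k)) - 1) / (N - 1))) ^ t"
      using pair_prob_eq[of q d k n m] qN N1 by (simp add: N_def c'_def power_mult_distrib power_mult)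
    show "real (n choose m) * real (d - 1) ^ (n - m) * pair_prob n d k q m ^ t
      = (real d ^ n * (1 - real q / N) ^ (2 * t)) * (binom_weight n (1 / real d) m *
      (1 + c' * ((N * (real (m choose k) / real (n choose k)) - 1) / (N - 1))) ^ t)"
      unfolding pp w[symmetric] binom_weight_def by (simp only: mult_ac)
  qed
  also have "\<dots> = e\<^sup>2 * (\<Sum>m\<le>n. binom_weight n (1 / real d) m *
      (1 + c' * ((N * (real (m choose k) / real (n choose k)) - 1) / (N - 1))) ^ t)"
    unfolding sum_distrib_left[symmetric] e_def
    by (simp add: power2_eq_square power_mult_distrib mult_2 power_add)
  also have "\<dots> \<le> e\<^sup>2 * R" using bound by (intro mult_left_mono) auto
  finally have "measure_pmf.expectation M (\<lambda>I. (num_solutions n d I)\<^sup>2) \<le> R * (measure_pmf.expectation M (num_solutions n d))\<^sup>2"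
    by (simp add: Ee mult.commute)
  moreover have "R > 0" unfolding R_def by (simp add: add_pos_nonneg add_nonneg_pos)
  ultimately have "measure_pmf.prob M {I. num_solutions n d I > 0} \<ge> 1 / R"
    using e by (intro second_moment_lower_bound[OF num_solutions_bounds]) (auto simp: Ee)
  then show ?thesis unfolding R_def rb_prob_sat_eq M_def t_def q_def d_def .
qed

subsection \<open>Asymptotics\<close>

lemma eventually_rb_dom_size:
  assumes "\<alpha> > 0"
  shows "eventually (\<lambda>n. n > 0 \<and> rb_dom_size n \<alpha> \<ge> 2 \<and> real (rb_dom_size n \<alpha>) \<ge> real n powr \<alpha> / 2 \<and>
    ln (real (rb_dom_size n \<alpha>)) \<le> \<alpha> * ln (real n)) sequentially"
  using eventually_powr_ge_2[OF assms] eventually_gt_at_top[of 0]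
proof eventually_elim
  case (elim n)
  note D = rb_dom_size_ge[OF elim(1)]
  have "ln (real (rb_dom_size n \<alpha>)) \<le> ln (real n powr \<alpha>)"
    using D(2) elim(2) rb_dom_size_le[of n \<alpha>] by (subst ln_le_cancel_iff) auto
  then show ?case using D elim(2) by (simp add: ln_powr)
qed

lemma filterlim_rb_dom_size:
  assumes "\<alpha> > 0"
  shows "filterlim (\<lambda>n. real (rb_dom_size n \<alpha>)) at_top sequentially"
proof (rule filterlim_at_top_mono)
  show "filterlim (\<lambda>n. real n powr \<alpha> / 2) at_top sequentially" using assms by real_asymp
  show "eventually (\<lambda>n. real n powr \<alpha> / 2 \<le> real (rb_dom_size n \<alpha>)) sequentially"
    using eventually_rb_dom_size[OF assms] by eventually_elim auto
qed

lemma rb_prob_sat_tendsto_0: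
  fixes k :: nat and \<alpha> r p :: real
  assumes k: "k \<ge> 1" and \<alpha>: "\<alpha> > 0" and r: "r > 0" and p: "0 < p" "p < 1"
    and rcr: "r > 1 / ln (1 / (1 - p))"
  shows "(\<lambda>n. rb_prob_sat n \<alpha> r k p) \<longlonglongrightarrow> 0"
proof -
  \<comment> \<open>The condition r > r_cr says 1 - p < exp (-1/r), and \<open>\<rho>\<close> is the
    midpoint. Being above 1 - p it absorbs the rounding of q; being below exp (-1/r) it gives 1 + r
    ln \<open>\<rho>\<close> < 0, so that d^n \<open>\<rho>\<close>^t still decays.\<close>
  define \<rho> where "\<rho> = ((1 - p) + exp (- (1 / r))) / 2"
  have lnp: "ln (1 / (1 - p)) > 0" using p by simp
  then have "1 / r < ln (1 / (1 - p))" using rcr r by (simp add: field_simps)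
  then have "ln (1 - p) < - (1 / r)" using p by (simp add: ln_div)
  then have "1 - p < exp (- (1 / r))" using p ln_less_cancel_iff[of "1 - p" "exp (- (1 / r))"] by simp
  then have \<rho>: "1 - p < \<rho>" "\<rho> < exp (- (1 / r))" by (simp_all add: \<rho>_def)
  have \<rho>0: "\<rho> > 0" using \<rho>(1) p by simp
  have "exp (- (1 / r)) < 1" using r by simp
  with \<rho>(2) have \<rho>1: "\<rho> < 1" by (rule less_trans)
  have "ln \<rho> < - (1 / r)" using \<rho>(2) \<rho>0 ln_less_cancel_iff[of \<rho> "exp (- (1 / r))"] by simp
  then have \<kappa>: "1 + r * ln \<rho> < 0" using r by (simp add: field_simps)
  have ln\<rho>: "ln \<rho> < 0" using \<rho>0 \<rho>1 by simp
  \<comment> \<open>From this size on, the rounding error 1/N in q/N is at most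
    \<open>\<rho>\<close> - (1 - p), whence 1 - q/N \<le> \<open>\<rho>\<close>.\<close>
  have "eventually (\<lambda>n. real (rb_dom_size n \<alpha>) \<ge> 1 / (\<rho> - (1 - p))) sequentially"
    using filterlim_rb_dom_size[OF \<alpha>] by (simp add: filterlim_at_top)
  then have le: "eventually (\<lambda>n. rb_prob_sat n \<alpha> r k p
      \<le> exp (ln 2 * (1 + r * ln \<rho>) * real n - ln \<rho>)) sequentially"
    using eventually_rb_dom_size[OF \<alpha>] eventually_ge_at_top[of k]
  proof eventually_elim
    case (elim n)
    define d where "d = rb_dom_size n \<alpha>"
    define t where "t = rb_num_constraints n \<alpha> r"
    define q where "q = rb_num_incompat d k p"
    have d: "d \<ge> 2" using elim(2) by (simp add: d_def)
    have "real d ^ 1 \<le> real d ^ k" using d k by (intro power_increasing) auto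
    then have dk: "real d \<le> real d ^ k" by simp
    have dpos: "real d ^ k > 0" using d by simp
    have "1 / real d ^ k \<le> 1 / real d" using dk d by (intro divide_left_mono) auto
    also have "\<dots> \<le> \<rho> - (1 - p)" using elim(1) d \<rho>(1) by (simp add: d_def field_simps)
    finally have inv: "1 / real d ^ k \<le> \<rho> - (1 - p)" .
    note q = rb_num_incompat_bounds[OF p, of d k, folded q_def]
    have "(p * real d ^ k - 1) / real d ^ k \<le> real q / real d ^ k"
      using q(2) d dpos by (intro divide_right_mono) auto
    moreover have "(p * real d ^ k - 1) / real d ^ k = p - 1 / real d ^ k"
      using d by (simp add: diff_divide_distrib)
    ultimately have "1 - real q / real d ^ k \<le> \<rho>" using inv by linarith
    moreover have "0 \<le> 1 - real q / real d ^ k"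
    proof -
      have "real q \<le> real (d ^ k)" using q(3) d by (intro of_nat_mono) auto
      then show ?thesis using dpos by simp
    qed
    ultimately have "(1 - real q / real d ^ k) ^ t \<le> \<rho> ^ t" by (intro power_mono)
    also have "\<rho> ^ t = exp (real t * ln \<rho>)" using \<rho>0 by (simp add: exp_of_nat_mult)
    also have "real t * ln \<rho> \<le> (r * real n * ln (real d) - 1) * ln \<rho>"
      using rb_num_constraints_bounds(2)[OF r, of n \<alpha>] d ln\<rho>
      by (intro mult_right_mono_neg) (auto simp: t_def d_def)
    finally have tt: "(1 - real q / real d ^ k) ^ t \<le> exp ((r * real n * ln (real d) - 1) * ln \<rho>)" by simp
    have "rb_prob_sat n \<alpha> r k p \<le> real d ^ n * (1 - real q / real d ^ k) ^ t"
      using rb_prob_sat_le[of k n \<alpha> p r] elim p d by (simp add: d_def t_def q_def)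
    also have "\<dots> \<le> real d ^ n * exp ((r * real n * ln (real d) - 1) * ln \<rho>)"
      using tt by (intro mult_left_mono) auto
    also have "real d ^ n = exp (real n * ln (real d))" using d by (simp add: exp_of_nat_mult)
    also have "exp (real n * ln (real d)) * exp ((r * real n * ln (real d) - 1) * ln \<rho>)
      = exp (ln (real d) * ((1 + r * ln \<rho>) * real n) - ln \<rho>)"
      by (simp add: exp_add[symmetric] algebra_simps)
    \<comment> \<open>The coefficient of ln d is not positive, so the smallest admissible d = 2
      gives an upper bound.\<close>
    also have "ln (real d) * ((1 + r * ln \<rho>) * real n) \<le> ln 2 * ((1 + r * ln \<rho>) * real n)"
      using d \<kappa> by (intro mult_right_mono_neg) (auto simp: mult_nonpos_nonneg)
    finally show ?case by (simp add: mult.assoc)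
  qed
  have lim: "(\<lambda>n. exp (ln 2 * (1 + r * ln \<rho>) * real n - ln \<rho>)) \<longlonglongrightarrow> 0"
  proof -
    define K where "K = ln 2 * (1 + r * ln \<rho>)"
    have "K < 0" using \<kappa> by (simp add: K_def mult_pos_neg)
    then have "(\<lambda>n. exp (K * real n - ln \<rho>)) \<longlonglongrightarrow> 0" by real_asymp
    then show ?thesis by (simp only: K_def)
  qed
  show ?thesis
    by (rule tendsto_sandwich[OF _ le tendsto_const lim]) (simp add: rb_prob_sat_def)
qed

lemma rb_prob_sat_tendsto_1:
  fixes k :: nat and \<alpha> r p :: real
  assumes k: "k \<ge> 2" and \<alpha>: "\<alpha> > 0" and r: "r > 0" and p: "0 < p" "p < 1"
    and k\<alpha>: "(2 * real k - 1) * \<alpha> > 1"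
    and kc: "real k \<ge> (1 / (1 - p)) * ln (1 / (1 - p)) / (1 / (1 - p) - 1)"
    and rcr: "r < 1 / ln (1 / (1 - p))"
  shows "(\<lambda>n. rb_prob_sat n \<alpha> r k p) \<longlonglongrightarrow> 1"
proof -
  define c where "c = 1 / (1 - p) - 1"
  define \<delta> where "\<delta> = 1 - r * ln (1 / (1 - p))"
  define D where "D n = real (rb_dom_size n \<alpha>)" for n
  \<comment> \<open>L must tend to infinity to kill exp (- L), while L/n = n^(-3/4) must be
    negligible in both cut-offs. This is also the origin of 3/4 in \<open>\<beta>\<close>, the decay
    rate of m1/n; g is the resulting rate for its power k - 1.\<close>
  define L where "L n = real n powr (1 / 4)" for n
  define \<theta> where "\<theta> n = 2 * r * c * real k * ln (D n) * ((8 * (real n / D n) + L n) / real n) ^ (k - 1)" for n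
  define \<beta> where "\<beta> = min \<alpha> (3 / 4)"
  define g where "g = \<beta> * real (k - 1)"
  define C where "C = 2 * r * c * real k * \<alpha> * 17 ^ (k - 1)"
  have c: "c > 0" using p by (simp add: c_def field_simps)
  have "ln (1 / (1 - p)) > 0" using p by simp
  then have \<delta>: "\<delta> > 0" using rcr by (simp add: \<delta>_def field_simps)
  have \<beta>: "\<beta> > 0" "\<beta> \<le> \<alpha>" "\<beta> \<le> 3 / 4" using \<alpha> by (auto simp: \<beta>_def)
  have g: "g > 0" using \<beta> k by (simp add: g_def)
  \<comment> \<open>Up to logarithms \<open>\<theta>\<^sup>2\<close> n/d is at most of order n to
    this exponent. For \<open>\<alpha>\<close> \<le> 3/4 the exponent equals 1 - (2k - 1)
    \<open>\<alpha>\<close>, so here the assumption on (2k - 1) \<open>\<alpha>\<close> enters; for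
    larger \<open>\<alpha>\<close>, k \<ge> 2 suffices.\<close>
  have exponent: "1 - \<alpha> - 2 * g < 0"
  proof (cases "\<alpha> \<le> 3 / 4")
    case True
    then show ?thesis using k\<alpha> k by (simp add: g_def \<beta>_def of_nat_diff algebra_simps)
  next
    case False
    have "1 \<le> real (k - 1)" using k by simp
    then show ?thesis using False \<alpha> by (simp add: g_def \<beta>_def)
  qed
  note ev = eventually_rb_dom_size[OF \<alpha>]
  have Linv: "L n / real n = real n powr (- 3 / 4)" if "n > 0" for n
    using that powr_diff[of "real n" "1 / 4" 1] by (simp add: L_def)
  have \<theta>_le: "eventually (\<lambda>n. 0 \<le> \<theta> n \<and> \<theta> n \<le> C * (ln (real n) * real n powr (- g))) sequentially"
    using ev
  proof eventually_elim
    case (elim n)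
    then have n: "real n \<ge> 1" and Dn: "D n \<ge> 2" "D n \<ge> real n powr \<alpha> / 2" "ln (D n) \<le> \<alpha> * ln (real n)"
      by (auto simp: D_def)
    have npos: "real n powr \<alpha> > 0" using n by simp
    have lnD: "ln (D n) \<ge> 0" using Dn by simp
    have "1 / D n \<le> 1 / (real n powr \<alpha> / 2)" using Dn npos by (intro divide_left_mono) auto
    also have "\<dots> = 2 * real n powr (- \<alpha>)" by (simp add: powr_minus divide_simps)
    also have "\<dots> \<le> 2 * real n powr (- \<beta>)" using n \<beta> by (intro mult_left_mono powr_mono) auto
    finally have 1: "1 / D n \<le> 2 * real n powr (- \<beta>)" .
    have 2: "L n / real n \<le> real n powr (- \<beta>)"
      using Linv[of n] n \<beta> by (auto intro!: powr_mono)
    have eq: "(8 * (real n / D n) + L n) / real n = 8 * (1 / D n) + L n / real n"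
      using n by (simp add: add_divide_distrib)
    \<comment> \<open>17 = 8 * 2 + 1, where the 2 comes from d \<ge> n^\<open>\<alpha>\<close> /
      2.\<close>
    have base: "(8 * (real n / D n) + L n) / real n \<le> 17 * real n powr (- \<beta>)"
      unfolding eq using 1 2 by simp
    have nonneg: "0 \<le> (8 * (real n / D n) + L n) / real n" using Dn by (simp add: L_def)
    have "((8 * (real n / D n) + L n) / real n) ^ (k - 1) \<le> (17 * real n powr (- \<beta>)) ^ (k - 1)"
      using base nonneg by (intro power_mono)
    also have "\<dots> = 17 ^ (k - 1) * real n powr (- g)"
      using n by (simp add: power_mult_distrib powr_power g_def mult.commute)
    finally have pw: "((8 * (real n / D n) + L n) / real n) ^ (k - 1) \<le> 17 ^ (k - 1) * real n powr (- g)" .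
    have "\<theta> n \<le> 2 * r * c * real k * (\<alpha> * ln (real n)) * (17 ^ (k - 1) * real n powr (- g))"
      unfolding \<theta>_def using pw Dn lnD nonneg r c n \<alpha> by (intro mult_mono) auto
    moreover have "0 \<le> \<theta> n" unfolding \<theta>_def using lnD nonneg r c by simp
    ultimately show ?case by (simp add: C_def mult_ac)
  qed
  have \<theta>0: "\<theta> \<longlonglongrightarrow> 0"
  proof (rule tendsto_sandwich[where f = "\<lambda>_. 0"])
    have "(\<lambda>n. ln (real n) * real n powr (- g)) \<longlonglongrightarrow> 0" using g by real_asymp
    then show "(\<lambda>n. C * (ln (real n) * real n powr (- g))) \<longlonglongrightarrow> 0"
      by (rule tendsto_mult_right_zero)
    show "eventually (\<lambda>n. 0 \<le> \<theta> n) sequentially" "eventually (\<lambda>n. \<theta> n \<le> C * (ln (real n) * real n powr (- g))) sequentially"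
      using \<theta>_le by (auto elim: eventually_mono)
  qed simp
  have var0: "(\<lambda>n. 4 * (\<theta> n)\<^sup>2 * (real n / D n)) \<longlonglongrightarrow> 0"
  proof (rule tendsto_sandwich[where f = "\<lambda>_. 0"])
    define a where "a = 1 - \<alpha> - 2 * g"
    have "a < 0" using exponent by (simp add: a_def)
    then have "(\<lambda>n. (ln (real n))\<^sup>2 * real n powr a) \<longlonglongrightarrow> 0" by real_asymp
    then show "(\<lambda>n. (8 * C\<^sup>2) * ((ln (real n))\<^sup>2 * real n powr a)) \<longlonglongrightarrow> 0"
      by (rule tendsto_mult_right_zero)
    show "eventually (\<lambda>n. 4 * (\<theta> n)\<^sup>2 * (real n / D n) \<le> (8 * C\<^sup>2) * ((ln (real n))\<^sup>2 * real n powr a)) sequentially"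
      using \<theta>_le ev
    proof eventually_elim
      case (elim n)
      then have n: "real n \<ge> 1" and Dn: "D n \<ge> 2" "D n \<ge> real n powr \<alpha> / 2" by (auto simp: D_def)
      have npos: "real n powr \<alpha> > 0" using n by simp
      have "real n / D n \<le> real n / (real n powr \<alpha> / 2)" using Dn npos by (intro divide_left_mono) auto
      also have "\<dots> = 2 * real n powr (1 - \<alpha>)" using n by (simp add: powr_diff)
      finally have q: "real n / D n \<le> 2 * real n powr (1 - \<alpha>)" .
      have "(\<theta> n)\<^sup>2 \<le> (C * (ln (real n) * real n powr (- g)))\<^sup>2" using elim by (intro power_mono) auto
      also have "\<dots> = C\<^sup>2 * ((ln (real n))\<^sup>2 * real n powr (- (2 * g)))"
        using n by (simp add: power_mult_distrib powr_power mult.commute)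
      finally have "4 * (\<theta> n)\<^sup>2 * (real n / D n) \<le> 4 * (C\<^sup>2 * ((ln (real n))\<^sup>2 * real n powr (- (2 * g)))) * (2 * real n powr (1 - \<alpha>))"
        using q Dn by (intro mult_mono) auto
      also have "real n powr a = real n powr (- (2 * g)) * real n powr (1 - \<alpha>)"
        by (simp add: a_def powr_add[symmetric])
      then have "4 * (C\<^sup>2 * ((ln (real n))\<^sup>2 * real n powr (- (2 * g)))) * (2 * real n powr (1 - \<alpha>))
        = (8 * C\<^sup>2) * ((ln (real n))\<^sup>2 * real n powr a)" by (simp only:)
      finally show ?case .
    qed
    show "eventually (\<lambda>n. 0 \<le> 4 * (\<theta> n)\<^sup>2 * (real n / D n)) sequentially" by (simp add: D_def)
  qed simp
  \<comment> \<open>An explicit upper bound for m2/n. It decays polynomially because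
    \<open>\<delta>\<close> > 0, that is, because r < r_cr.\<close>
  define h where "h n = 3 * 2 powr \<delta> * real n powr (- (\<alpha> * \<delta>)) + real n powr (- 3 / 4)" for n
  have \<alpha>\<delta>: "\<alpha> * \<delta> > 0" using \<alpha> \<delta> by simp
  have h0: "h \<longlonglongrightarrow> 0" and lnh: "(\<lambda>n. ln (real n) * h n) \<longlonglongrightarrow> 0"
  proof -
    define a b where "a = \<alpha> * \<delta>" and "b = 3 * 2 powr \<delta>"
    have "a > 0" using \<alpha>\<delta> by (simp add: a_def)
    then have "(\<lambda>n. real n powr (- a)) \<longlonglongrightarrow> 0" and lna: "(\<lambda>n. ln (real n) * real n powr (- a)) \<longlonglongrightarrow> 0"
      by real_asymp+
    moreover have "(\<lambda>n. real n powr (- 3 / 4)) \<longlonglongrightarrow> 0" and ln34: "(\<lambda>n. ln (real n) * real n powr (- 3 / 4)) \<longlonglongrightarrow> 0"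
      by real_asymp+
    ultimately have "(\<lambda>n. b * real n powr (- a) + real n powr (- 3 / 4)) \<longlonglongrightarrow> b * 0 + 0"
      by (intro tendsto_intros)
    then show "h \<longlonglongrightarrow> 0" by (simp add: h_def[abs_def] a_def b_def)
    have "(\<lambda>n. b * (ln (real n) * real n powr (- a)) + ln (real n) * real n powr (- 3 / 4)) \<longlonglongrightarrow> b * 0 + 0"
      by (intro tendsto_intros lna ln34)
    then show "(\<lambda>n. ln (real n) * h n) \<longlonglongrightarrow> 0"
      by (simp add: h_def[abs_def] a_def b_def algebra_simps)
  qed
  have lnh0: "(\<lambda>n. r * c * \<alpha> * (ln (real n) * h n)) \<longlonglongrightarrow> 0"
    by (rule tendsto_mult_right_zero[OF lnh])
  have "eventually (\<lambda>n. h n < 1) sequentially" "eventually (\<lambda>n. r * c * \<alpha> * (ln (real n) * h n) < 1) sequentially"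
    using h0 lnh0 by (auto intro: order_tendstoD(2))
  then have \<eta>: "eventually (\<lambda>n. r * c * ln (D n) * ((3 * (real n * D n powr (- \<delta>)) + L n) / real n) ^ (k - 1) \<le> 1) sequentially"
    using ev
  proof eventually_elim
    case (elim n)
    then have n: "real n \<ge> 1" and Dn: "D n \<ge> 2" "D n \<ge> real n powr \<alpha> / 2" "ln (D n) \<le> \<alpha> * ln (real n)"
      by (auto simp: D_def)
    have npos: "real n powr \<alpha> > 0" using n by simp
    define x where "x = (3 * (real n * D n powr (- \<delta>)) + L n) / real n"
    have "D n powr (- \<delta>) \<le> (real n powr \<alpha> / 2) powr (- \<delta>)"
      using Dn npos \<delta> by (intro powr_mono2') auto
    also have "\<dots> = 2 powr \<delta> * real n powr (- (\<alpha> * \<delta>))"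
      using n by (simp add: powr_divide powr_powr powr_minus field_simps)
    finally have "x \<le> h n"
      using n Linv[of n] by (simp add: x_def h_def add_divide_distrib)
    moreover have x0: "0 \<le> x" using n by (simp add: x_def L_def)
    \<comment> \<open>Since x \<le> h n < 1 and k - 1 \<ge> 1, the first power is enough, and ln n
      times h n already tends to 0.\<close>
    moreover have "x ^ (k - 1) \<le> x ^ 1"
      using x0 calculation(1) elim(1) k by (intro power_decreasing) auto
    ultimately have "x ^ (k - 1) \<le> h n" by simp
    then have "r * c * ln (D n) * x ^ (k - 1) \<le> r * c * (\<alpha> * ln (real n)) * h n"
      using Dn r c x0 \<alpha> n by (intro mult_mono) auto
    then show ?case using elim(2) by (simp add: x_def mult_ac)
  qed
  define R where "R n = 1 + 2 * sqrt (exp (4 * (\<theta> n)\<^sup>2 * (real n / D n)) - 1) + 2 * exp (- L n)" for n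
  have "R \<longlonglongrightarrow> 1 + 2 * sqrt (exp 0 - 1) + 2 * 0"
    unfolding R_def
  proof (intro tendsto_intros var0)
    show "(\<lambda>n. exp (- L n)) \<longlonglongrightarrow> 0" unfolding L_def by real_asymp
  qed
  then have "(\<lambda>n. 1 / R n) \<longlonglongrightarrow> 1 / 1" by (intro tendsto_divide) auto
  then have R: "(\<lambda>n. 1 / R n) \<longlonglongrightarrow> 1" by simp
  have "eventually (\<lambda>n. \<theta> n < 1 / 2) sequentially" by (rule order_tendstoD(2)[OF \<theta>0]) simp
  then have lower: "eventually (\<lambda>n. 1 / R n \<le> rb_prob_sat n \<alpha> r k p) sequentially"
    using \<eta> ev eventually_ge_at_top[of k]
  proof eventually_elim
    case (elim n)
    then show ?case unfolding R_def \<theta>_def D_def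
      using k p r kc[folded c_def] by (intro rb_prob_sat_ge[of k n \<alpha> p r "L n", folded c_def \<delta>_def]) (auto simp: L_def \<theta>_def D_def)
  qed
  show ?thesis
    by (rule tendsto_sandwich[OF lower _ R tendsto_const]) (simp add: rb_prob_sat_def)
qed

theorem theorem3p1:
  fixes k :: nat and \<alpha> r p :: real
  assumes "k \<ge> 2" and "\<alpha> > 0" and "r > 0" and "0 < p" and "p < 1"
    and "(2 * real k - 1) * \<alpha> > 1"
    and "real k \<ge> (1 / (1 - p)) * ln (1 / (1 - p)) / (1 / (1 - p) - 1)"
  shows "(r < 1 / ln (1 / (1 - p)) \<longrightarrow> (\<lambda>n. rb_prob_sat n \<alpha> r k p) \<longlonglongrightarrow> 1)
       \<and> (r > 1 / ln (1 / (1 - p)) \<longrightarrow> (\<lambda>n. rb_prob_sat n \<alpha> r k p) \<longlonglongrightarrow> 0)"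
  using rb_prob_sat_tendsto_1[OF assms] rb_prob_sat_tendsto_0[of k \<alpha> r p] assms by simp

end
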